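(* Let $1<p\le\infty$, let $q\ge 2$, let $s$ be such that $\frac1s+\frac1q=1$, and let $0<q'\le q$. If $f\in X^p(\omega)_s$ and $0\le k_0<k_1<k_2<\dots<k_r$ are integers (so $k_r\ge r$), then $$\left\|\left\{\frac1{r+1}\sum_{\nu=0}^r\left|S_{k_\nu}f(\cdot)-f(\cdot)\right|^{q'}\right\}^{1/q'}\right\|_{X^p}\ll \omega\!\left(\frac{\pi}{k_0+1}\right)\log\frac{k_r+1}{r+1/2}.$$
   Context: $I_1\ll I_2$ means that there is a positive constant $K$, sometimes depending on some parameters, such that $I_1\le K I_2$. For $1<p<\infty$, $X^p=L^p$ is the space of $2\pi$-periodic real-valued functions with Lebesgue integrable $p$-th power over $Q=[-\pi,\pi]$, with $\|f\|_{X^p}=(\int_Q|f(x)|^p\,dx)^{1/p}$; $X^\infty=C$ is the space of $2\pi$-periodic continuous real-valued functions with $\|f\|_{X^\infty}=\sup_{x\in Q}|f(x)|$. $S_kf$ denotes the $k$-th partial sum of the trigonometric Fourier series of $f$. Put $\varphi_x(t)=f(x+t)+f(x-t)-2f(x)$ and, for $\gamma>0$ and $s>1$, $$G_x^{\circ}f(\gamma)_{1,s}=\sup_{0<\delta\le\gamma}\left\{\sum_{k=1}^{[\pi/\delta]}\left(\frac1{k\delta}\int_{(k-1)\delta}^{k\delta}|\varphi_x(t)|\,dt\right)^{s}\right\}^{1/s},$$ where $[\cdot]$ is the integer part. Here $\omega$ is a modulus of continuity, i.e. a nondecreasing continuous function on $[0,\infty)$ with $\omega(0)=0$ and $\omega(\delta_1+\delta_2)\le\omega(\delta_1)+\omega(\delta_2)$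 for $0\le\delta_1\le\delta_2$. $X^p(\omega)_s$ is the set of $f\in X^p$ with $\|G_\cdot^{\circ}f(\delta)_{1,s}\|_{X^p}\le\omega(\delta)$ for $\delta>0$.
   Formalization: The constant in ≪ depends on p, q, s, q' and, in a nonincreasing way, on (k_r+1)/(r+1/2), so it is uniform only while this ratio stays away from 1; with a fully uniform constant the claim fails (f = cos, k_ν = ν, r large). *)

theory Defs
  imports "HOL-Analysis.Analysis"
begin

definition periodic_2pi :: "(real \<Rightarrow> real) \<Rightarrow> bool" where
  "periodic_2pi f \<longleftrightarrow> (\<forall>x. f (x + 2 * pi) = f x)"

text \<open>The exponent \<open>p = \<infinity>\<close> stands for the space \<open>C\<close> of
  continuous functions, not for essentially bounded ones. Functions are not identified
  almost everywhere.\<close>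

definition Xp :: "ennreal \<Rightarrow> (real \<Rightarrow> real) set" where
  "Xp p = {f. periodic_2pi f \<and>
     (if p = \<infinity> then continuous_on UNIV f
      else f \<in> borel_measurable lebesgue \<and>
           set_integrable lebesgue {-pi..pi} (\<lambda>x. \<bar>f x\<bar> powr enn2real p))}"

text \<open>Real powers on \<open>[0, \<infinity>]\<close>, used for positive exponents only.\<close>

definition epow :: "ennreal \<Rightarrow> real \<Rightarrow> ennreal" where
  "epow x a = (if x = \<infinity> then \<infinity> else ennreal (enn2real x powr a))"

text \<open>The norm is taken of a function with values in \<open>[0, \<infinity>]\<close> (the modulus of a real function,
  or the pointwise characteristic below, which may be infinite at some points).\<close>

definition Xnorm :: "ennreal \<Rightarrow> (real \<Rightarrow> ennreal) \<Rightarrow> ennreal" where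
  "Xnorm p g =
     (if p = \<infinity> then (SUP x\<in>{-pi..pi}. g x)
      else epow (\<integral>\<^sup>+x\<in>{-pi..pi}. epow (g x) (enn2real p) \<partial>lebesgue) (1 / enn2real p))"

definition fourier_cos :: "(real \<Rightarrow> real) \<Rightarrow> nat \<Rightarrow> real" where
  "fourier_cos f j = 1 / pi * (LINT t:{-pi..pi}|lebesgue. f t * cos (real j * t))"

definition fourier_sin :: "(real \<Rightarrow> real) \<Rightarrow> nat \<Rightarrow> real" where
  "fourier_sin f j = 1 / pi * (LINT t:{-pi..pi}|lebesgue. f t * sin (real j * t))"

definition fourier_partial_sum :: "nat \<Rightarrow> (real \<Rightarrow> real) \<Rightarrow> real \<Rightarrow> real" where
  "fourier_partial_sum k f x =
     fourier_cos f 0 / 2 +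
     (\<Sum>j = 1..k. fourier_cos f j * cos (real j * x) + fourier_sin f j * sin (real j * x))"

definition sym_diff2 :: "(real \<Rightarrow> real) \<Rightarrow> real \<Rightarrow> real \<Rightarrow> real" where
  "sym_diff2 f x t = f (x + t) + f (x - t) - 2 * f x"

text \<open>\<open>Gcirc s f x \<gamma>\<close> is the quantity \<open>G\<^sub>x\<^sup>\<circ> f(\<gamma>)\<^bsub>1,s\<^esub>\<close>. For \<open>\<delta> > pi\<close> the sum is empty.\<close>

definition Gcirc :: "real \<Rightarrow> (real \<Rightarrow> real) \<Rightarrow> real \<Rightarrow> real \<Rightarrow> ennreal" where
  "Gcirc s f x \<gamma> =
     (SUP \<delta>\<in>{0<..\<gamma>}. ennreal
       ((\<Sum>k = 1..nat \<lfloor>pi / \<delta>\<rfloor>.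
          (1 / (real k * \<delta>) *
             (LINT t:{(real k - 1) * \<delta>..real k * \<delta>}|lebesgue. \<bar>sym_diff2 f x t\<bar>)) powr s)
        powr (1 / s)))"

definition modulus_of_continuity :: "(real \<Rightarrow> real) \<Rightarrow> bool" where
  "modulus_of_continuity \<omega> \<longleftrightarrow>
     mono_on {0..} \<omega> \<and> continuous_on {0..} \<omega> \<and> \<omega> 0 = 0 \<and>
     (\<forall>a b. 0 \<le> a \<and> a \<le> b \<longrightarrow> \<omega> (a + b) \<le> \<omega> a + \<omega> b)"

definition Xp_class :: "ennreal \<Rightarrow> real \<Rightarrow> (real \<Rightarrow> real) \<Rightarrow> (real \<Rightarrow> real) set" where
  "Xp_class p s \<omega> =
     {f \<in> Xp p. \<forall>\<delta>>0. Xnorm p (\<lambda>x. Gcirc s f x \<delta>) \<le> ennreal (\<omega> \<delta>)}"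

definition strong_mean ::
    "real \<Rightarrow> nat \<Rightarrow> (nat \<Rightarrow> nat) \<Rightarrow> (real \<Rightarrow> real) \<Rightarrow> real \<Rightarrow> real" where
  "strong_mean q' r k f x =
     (1 / (real r + 1) * (\<Sum>\<nu> = 0..r. \<bar>fourier_partial_sum (k \<nu>) f x - f x\<bar> powr q'))
     powr (1 / q')"

text \<open>The argument of the logarithm in the estimate; it is always \<open>> 1\<close>, but it can be
  arbitrarily close to \<open>1\<close> (take \<open>k \<nu> = \<nu>\<close> and \<open>r\<close> large). In that limit no constant is
  uniform in \<open>r\<close>: for \<open>f = cos\<close> and \<open>k \<nu> = \<nu>\<close> the strong mean has norm of order
  \<open>(r + 1) powr (- 1 / q')\<close>, while the logarithm is of order \<open>1 / r\<close>. So the constant in the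
  estimate depends on this quantity, but only in a nonincreasing way: it is uniform as long
  as the argument stays away from \<open>1\<close>.\<close>

definition log_arg :: "nat \<Rightarrow> (nat \<Rightarrow> nat) \<Rightarrow> real" where
  "log_arg r k = (real (k r) + 1) / (real r + 1 / 2)"

end

theory Submission
  imports Defs
begin

text \<open>Write \<open>f = h + g\<close>, where \<open>h\<close> is the Fejer mean of order \<open>k 0\<close>. The Fejer kernel of order
  \<open>n\<close> is at most \<open>2 (n + 1) / m\<^sup>2\<close> on the \<open>m\<close>-th interval of length \<open>pi / (n + 1)\<close>, so Hoelder's
  inequality with the exponents \<open>s\<close> and \<open>q\<close> bounds \<open>\<bar>g x\<bar>\<close> pointwise by a multiple of
  \<open>Gcirc s f x (pi / (k 0 + 1))\<close>. Partial sums of order at least \<open>k 0\<close> reproduce \<open>h\<close>, so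
  \<open>f\<close> and \<open>g\<close> have the same strong mean, and it remains to show that the strong mean of an
  arbitrary \<open>g\<close> has norm at most \<open>C (1 + ln (N / (r + 1)))\<close> times the norm of \<open>g\<close>, where
  \<open>N = k r + 1\<close>.

  For this the Dirichlet integral of \<open>g\<close> is split over the zones
  \<open>pi 2\<^bsup>j-1\<^esup> / N < \<bar>t\<bar> \<le> pi 2\<^bsup>j\<^esup> / N\<close>. Each zone contributes at most a local \<open>L\<^sup>P\<close> average of
  \<open>g\<close>, uniformly in the order of the partial sum. Once the radius \<open>H\<close> exceeds \<open>1 / (r + 1)\<close>, the
  orthogonality of the functions \<open>sin ((k + 1/2) t)\<close> and a truncation of \<open>g\<close> improve the mean
  square over the \<open>r + 1\<close> orders, hence the \<open>q\<close>-th power mean, by a negative power of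
  \<open>(r + 1) H\<close>; this is where \<open>P > 1\<close> is needed. So about \<open>ln (N / (r + 1))\<close> zones count fully
  and the others form a geometric series.\<close>

subsection \<open>Power means and Minkowski's inequality\<close>

text \<open>Subtracting \<open>h\<close> separates two tasks: the smoothness of \<open>f\<close> is
  spent entirely on the pointwise bound of \<open>g\<close>, and the logarithm is the norm of an
  operator acting on an arbitrary \<open>g\<close>. The obstacle is that \<open>P\<close> may be
  close to \<open>1\<close>: then \<open>g\<close> need not be locally square integrable, and
  orthogonality, a mean-square fact, cannot be applied to \<open>g\<close> itself. It is applied
  instead to a sine polynomial dual to the sequence of zone integrals, and \<open>g\<close> enters
  only through truncation. The local averages are taken with the exponent \<open>P\<close> of the
  norm. Fubini and translation invariance then integrate them over \<open>x\<close> to a multiple of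
  the integral of \<open>\<bar>g\<bar> powr P\<close>, so no maximal function is involved. The
  summand \<open>1\<close> beside the logarithm comes from the term \<open>g x\<close>, from
  rounding the number of full zones, and from the geometric tail. It does not vanish when
  \<open>log_arg\<close> tends to \<open>1\<close>; this is why the final constant has the form
  \<open>C * (1 + 1 / ln \<rho>)\<close>.\<close>

lemma powr_convex_nonneg:
  fixes p :: real
  assumes "p \<ge> 1"
  shows "convex_on {0..} (\<lambda>x. x powr p)"
proof (rule convex_onI)
  fix t x y :: real
  assume t: "0 < t" "t < 1" and xy: "x \<in> {0..}" "y \<in> {0..}"
  have *: "(c * z) powr p \<le> c * z powr p" if "0 < c" "c < 1" "0 \<le> z" for c z :: real
  proof -
    have "c powr p \<le> c powr 1" using that assms by (intro powr_mono') auto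
    then show ?thesis using that by (auto simp: powr_mult intro!: mult_right_mono)
  qed
  show "((1 - t) *\<^sub>R x + t *\<^sub>R y) powr p \<le> (1 - t) * x powr p + t * y powr p"
  proof (cases "x = 0 \<or> y = 0")
    case True
    then show ?thesis using *[of t y] *[of "1 - t" x] t xy by auto
  next
    case False
    then show ?thesis
      using convex_onD[OF powr_convex[OF assms], of t x y] t xy by auto
  qed
qed auto

text \<open>Jensen's inequality with the weights normalised by their sum \<open>W\<close>; undoing
  the normalisation leaves \<open>W powr (p - 1)\<close>. A power of a weighted sum becomes a
  weighted sum of powers, which can be integrated term by term.\<close>

lemma weighted_powr_mean:
  fixes w y :: "'a \<Rightarrow> real" and p :: real
  assumes fin: "finite J" and p: "p \<ge> 1"
    and w: "\<And>j. j \<in> J \<Longrightarrow> 0 < w j" and y: "\<And>j. j \<in> J \<Longrightarrow> 0 \<le> y j"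
  shows "(\<Sum>j\<in>J. w j * y j) powr p \<le> (\<Sum>j\<in>J. w j) powr (p - 1) * (\<Sum>j\<in>J. w j * y j powr p)"
proof (cases "J = {}")
  case False
  define W where "W = (\<Sum>j\<in>J. w j)"
  have W: "W > 0" unfolding W_def using fin False w by (intro sum_pos) auto
  have "(\<Sum>j\<in>J. (w j / W) *\<^sub>R y j) powr p \<le> (\<Sum>j\<in>J. (w j / W) * y j powr p)"
  proof (intro convex_on_sum[OF _ _ powr_convex_nonneg] fin False p)
    show "(\<Sum>j\<in>J. w j / W) = 1"
      using W by (simp add: sum_divide_distrib[symmetric] W_def)
    show "\<And>j. j \<in> J \<Longrightarrow> 0 \<le> w j / W" using w W by (simp add: less_imp_le)
  qed (use y in auto)
  also have "(\<Sum>j\<in>J. (w j / W) *\<^sub>R y j) = (\<Sum>j\<in>J. w j * y j) / W"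
    by (simp add: sum_divide_distrib)
  also have "(\<Sum>j\<in>J. (w j / W) * y j powr p) = (\<Sum>j\<in>J. w j * y j powr p) / W"
    by (simp add: sum_divide_distrib)
  finally have "(\<Sum>j\<in>J. w j * y j) powr p / W powr p \<le> (\<Sum>j\<in>J. w j * y j powr p) / W"
    using w y W by (subst powr_divide[symmetric]) (auto intro!: sum_nonneg mult_nonneg_nonneg less_imp_le)
  then have "(\<Sum>j\<in>J. w j * y j) powr p \<le> (\<Sum>j\<in>J. w j * y j powr p) * (W powr p / W)"
    using W by (simp add: field_simps)
  also have "W powr p / W = W powr (p - 1)"
    using W by (simp add: powr_diff)
  finally show ?thesis by (simp add: W_def mult.commute)
qed auto

text \<open>Jensen's inequality for each \<open>i\<close>, with weights \<open>A j\<close> and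
  values \<open>\<bar>F i j\<bar> / A j\<close>, followed by summation over \<open>i\<close>.
  Positive upper bounds \<open>A j\<close> in place of the exact \<open>q\<close>-norms keep the
  quotients meaningful.\<close>

lemma minkowski_sum:
  fixes F :: "'a \<Rightarrow> 'b \<Rightarrow> real" and q :: real
  assumes fin: "finite I" "finite J" and q: "q \<ge> 1"
    and A: "\<And>j. j \<in> J \<Longrightarrow> 0 < A j"
    and F: "\<And>j. j \<in> J \<Longrightarrow> (\<Sum>i\<in>I. \<bar>F i j\<bar> powr q) \<le> A j powr q"
  shows "(\<Sum>i\<in>I. \<bar>\<Sum>j\<in>J. F i j\<bar> powr q) \<le> (\<Sum>j\<in>J. A j) powr q"
proof (cases "J = {}")
  case False
  define W where "W = (\<Sum>j\<in>J. A j)"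
  have W: "W > 0" unfolding W_def using fin False A by (intro sum_pos) auto
  have "(\<Sum>i\<in>I. \<bar>\<Sum>j\<in>J. F i j\<bar> powr q)
      \<le> (\<Sum>i\<in>I. W powr (q - 1) * (\<Sum>j\<in>J. A j * (\<bar>F i j\<bar> / A j) powr q))"
  proof (rule sum_mono)
    fix i assume "i \<in> I"
    have "\<bar>\<Sum>j\<in>J. F i j\<bar> \<le> (\<Sum>j\<in>J. \<bar>F i j\<bar>)" by (rule sum_abs)
    also have "\<dots> = (\<Sum>j\<in>J. A j * (\<bar>F i j\<bar> / A j))"
      by (intro sum.cong refl) (use A in force)
    finally have "\<bar>\<Sum>j\<in>J. F i j\<bar> powr q \<le> (\<Sum>j\<in>J. A j * (\<bar>F i j\<bar> / A j)) powr q"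
      using q by (intro powr_mono2) auto
    also have "\<dots> \<le> W powr (q - 1) * (\<Sum>j\<in>J. A j * (\<bar>F i j\<bar> / A j) powr q)"
      unfolding W_def using fin q A by (intro weighted_powr_mean) (auto intro!: divide_nonneg_pos)
    finally show "\<bar>\<Sum>j\<in>J. F i j\<bar> powr q \<le> W powr (q - 1) * (\<Sum>j\<in>J. A j * (\<bar>F i j\<bar> / A j) powr q)" .
  qed
  also have "\<dots> = W powr (q - 1) * (\<Sum>j\<in>J. A j * (\<Sum>i\<in>I. \<bar>F i j\<bar> powr q) / A j powr q)"
    unfolding sum_distrib_left[symmetric]
    by (subst sum.swap)
       (use A in \<open>auto simp: sum_distrib_left sum_divide_distrib powr_divide less_imp_le intro!: sum.cong\<close>)
  also have "\<dots> \<le> W powr (q - 1) * (\<Sum>j\<in>J. A j)"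
  proof (intro mult_left_mono sum_mono)
    fix j assume j: "j \<in> J"
    have "A j * (\<Sum>i\<in>I. \<bar>F i j\<bar> powr q) \<le> A j * A j powr q"
      using F[OF j] A[OF j] by (intro mult_left_mono) auto
    then show "A j * (\<Sum>i\<in>I. \<bar>F i j\<bar> powr q) / A j powr q \<le> A j"
      using A[OF j] by (simp add: divide_le_eq)
  qed auto
  also have "\<dots> = W powr q" using W by (simp add: W_def[symmetric] powr_diff)
  finally show ?thesis by (simp add: W_def)
qed (use q in auto)

text \<open>Jensen's inequality with exponent \<open>b / a\<close> and equal weights. It replaces
  the exponent \<open>q'\<close> of the strong mean by \<open>q \<ge> 2\<close>, where mean squares
  are available.\<close>

lemma powr_mean_mono:
  fixes y :: "'a \<Rightarrow> real"
  assumes "finite I" "I \<noteq> {}" "0 < a" "a \<le> b" "\<And>i. i \<in> I \<Longrightarrow> 0 \<le> y i"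
  shows "(1 / card I * (\<Sum>i\<in>I. y i powr a)) powr (1 / a)
       \<le> (1 / card I * (\<Sum>i\<in>I. y i powr b)) powr (1 / b)"
proof -
  have c: "card I > 0" using assms by (simp add: card_gt_0_iff)
  have "(1 / card I * (\<Sum>i\<in>I. y i powr a)) powr (b / a)
      = (\<Sum>i\<in>I. 1 / card I * (y i powr a)) powr (b / a)"
    by (simp add: sum_distrib_left)
  also have "\<dots> \<le> (\<Sum>i\<in>I. 1 / card I) powr (b / a - 1) * (\<Sum>i\<in>I. 1 / card I * (y i powr a) powr (b / a))"
    using assms c by (intro weighted_powr_mean) auto
  also have "\<dots> = 1 / card I * (\<Sum>i\<in>I. y i powr b)"
    using c assms by (simp add: powr_powr sum_distrib_left)
  finally have "((1 / card I * (\<Sum>i\<in>I. y i powr a)) powr (b / a)) powr (1 / b)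
     \<le> (1 / card I * (\<Sum>i\<in>I. y i powr b)) powr (1 / b)"
    using assms by (intro powr_mono2) auto
  then show ?thesis using assms by (simp add: powr_powr)
qed

section \<open>The Dirichlet kernel and orthogonality of half-integer sines\<close>

definition dirichlet :: "nat \<Rightarrow> real \<Rightarrow> real" where
  "dirichlet k t = 1 / 2 + (\<Sum>j = 1..k. cos (real j * t))"

lemma sin_half_mult_dirichlet: "2 * sin (t / 2) * dirichlet k t = sin ((real k + 1 / 2) * t)"
proof (induction k)
  case (Suc k)
  have "2 * sin (t / 2) * dirichlet (Suc k) t
      = sin ((real k + 1 / 2) * t) + 2 * sin (t / 2) * cos (real (Suc k) * t)"
    using Suc by (simp add: dirichlet_def algebra_simps)
  also have "2 * sin (t / 2) * cos (real (Suc k) * t)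
      = sin ((real (Suc k) + 1 / 2) * t) - sin ((real k + 1 / 2) * t)"
  proof -
    have "(real (Suc k) + 1 / 2) * t = real (Suc k) * t + t / 2"
      and "(real k + 1 / 2) * t = real (Suc k) * t - t / 2" by (simp_all add: field_simps)
    then show ?thesis by (simp only: sin_add sin_diff) (simp add: mult.commute)
  qed
  finally show ?case by simp
qed (simp add: dirichlet_def)

lemma abs_dirichlet_le: "\<bar>dirichlet k t\<bar> \<le> real k + 1 / 2"
proof -
  have "\<bar>\<Sum>j = 1..k. cos (real j * t)\<bar> \<le> (\<Sum>j = 1..k. 1)"
    by (rule order_trans[OF sum_abs sum_mono]) auto
  then show ?thesis by (simp add: dirichlet_def)
qed

lemma continuous_on_dirichlet [continuous_intros]:
  "continuous_on S g \<Longrightarrow> continuous_on S (\<lambda>t. dirichlet k (g t))" for S :: "real set"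
  unfolding dirichlet_def by (auto intro!: continuous_intros)

lemma dirichlet_minus [simp]: "dirichlet k (- t) = dirichlet k t"
  by (simp add: dirichlet_def)

lemma abs_sin_half_ge:
  assumes "\<bar>t\<bar> \<le> pi"
  shows "\<bar>t\<bar> / pi \<le> \<bar>sin (t / 2)\<bar>"
proof -
  have *: "t / pi \<le> sin (t / 2)" if "0 \<le> t" "t \<le> pi" for t :: real
  proof -
    have "concave_on {0..pi} sin"
    proof (rule f''_le0_imp_concave[where f' = cos and f'' = "\<lambda>x. - sin x"])
      show "\<And>x. x \<in> {0..pi} \<Longrightarrow> - sin x \<le> 0" by (simp add: sin_ge_zero)
    qed (auto intro!: derivative_eq_intros)
    \<comment> \<open>The chord of the sine runs from \<open>0\<close> to \<open>pi / 2\<close>, and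
      \<open>t / 2\<close> is the fraction \<open>t / pi\<close> of the way along it.\<close>
    from concave_onD[OF this, of "t / pi" 0 "pi / 2"] that
    show ?thesis by (simp add: field_simps)
  qed
  show ?thesis
  proof (cases "t \<ge> 0")
    case True
    then show ?thesis using *[of t] assms by auto
  next
    case False
    then show ?thesis using *[of "-t"] assms by auto
  qed
qed

lemma integral_cos_multiple:
  fixes n :: int
  shows "((\<lambda>t. cos (of_int n * t)) has_integral (if n = 0 then 2 * pi else 0)) {-pi..pi}"
proof (cases "n = 0")
  case True
  then show ?thesis using has_integral_const_real[of "1::real" "-pi" pi] by simp
next
  case False
  have "((\<lambda>t. cos (of_int n * t)) has_integral sin (of_int n * pi) / of_int n - sin (of_int n * - pi) / of_int n) {-pi..pi}"
    using False
    by (intro fundamental_theorem_of_calculus)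
       (auto intro!: derivative_eq_intros simp: has_real_derivative_iff_has_vector_derivative[symmetric])
  then show ?thesis using False sin_integer_2pi[of n]
    by (simp add: sin_zero_iff_int2 mult.commute)
qed

lemma integral_sin_multiple:
  fixes n :: int
  shows "((\<lambda>t. sin (of_int n * t)) has_integral 0) {-pi..pi}"
proof (cases "n = 0")
  case False
  have "((\<lambda>t. sin (of_int n * t)) has_integral - cos (of_int n * pi) / of_int n - - cos (of_int n * - pi) / of_int n) {-pi..pi}"
    using False
    by (intro fundamental_theorem_of_calculus)
       (auto intro!: derivative_eq_intros simp: has_real_derivative_iff_has_vector_derivative[symmetric])
  then show ?thesis by simp
qed auto

lemma set_integral_Icc_eq_has_integral:
  fixes f :: "real \<Rightarrow> real"
  assumes "continuous_on {a..b} f" "(f has_integral I) {a..b}"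
  shows "(LINT t:{a..b}|lebesgue. f t) = I"
proof -
  have "f absolutely_integrable_on {a..b}"
    by (intro absolutely_integrable_continuous_real assms)
  then show ?thesis
    using assms(2) by (simp add: set_lebesgue_integral_eq_integral integral_unique)
qed

text \<open>A product of two half-integer sines is half a difference of cosines of integer
  frequency. The sum frequency is at least \<open>1\<close> and never contributes; by injectivity
  the difference frequency vanishes only on the diagonal.\<close>

lemma has_integral_sin_half_square:
  fixes c :: "'a \<Rightarrow> real" and k :: "'a \<Rightarrow> nat"
  assumes "finite A" "inj_on k A"
  shows "((\<lambda>t. (\<Sum>\<nu>\<in>A. c \<nu> * sin ((real (k \<nu>) + 1 / 2) * t))\<^sup>2) has_integral pi * (\<Sum>\<nu>\<in>A. (c \<nu>)\<^sup>2)) {-pi..pi}"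
proof -
  have e: "(\<Sum>\<nu>\<in>A. c \<nu> * sin ((real (k \<nu>) + 1 / 2) * t))\<^sup>2
     = (\<Sum>\<nu>\<in>A. \<Sum>\<mu>\<in>A. c \<nu> * c \<mu> / 2 *
        (cos (of_int (int (k \<nu>) - int (k \<mu>)) * t) - cos (of_int (int (k \<nu>) + int (k \<mu>) + 1) * t)))" for t
    unfolding power2_eq_square sum_product
  proof (intro sum.cong refl)
    fix \<nu> \<mu>
    have "(real (k \<nu>) + 1 / 2) * t - (real (k \<mu>) + 1 / 2) * t = of_int (int (k \<nu>) - int (k \<mu>)) * t"
      and "(real (k \<nu>) + 1 / 2) * t + (real (k \<mu>) + 1 / 2) * t = of_int (int (k \<nu>) + int (k \<mu>) + 1) * t"
      by (simp_all add: algebra_simps)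
    then have "sin ((real (k \<nu>) + 1 / 2) * t) * sin ((real (k \<mu>) + 1 / 2) * t) =
       (cos (of_int (int (k \<nu>) - int (k \<mu>)) * t) - cos (of_int (int (k \<nu>) + int (k \<mu>) + 1) * t)) / 2"
      by (simp only: sin_times_sin)
    then show "c \<nu> * sin ((real (k \<nu>) + 1 / 2) * t) * (c \<mu> * sin ((real (k \<mu>) + 1 / 2) * t)) =
        c \<nu> * c \<mu> / 2 *
        (cos (of_int (int (k \<nu>) - int (k \<mu>)) * t) - cos (of_int (int (k \<nu>) + int (k \<mu>) + 1) * t))"
      by (subst mult.assoc, subst mult.left_commute[of "sin _"], simp)
  qed
  have i: "((\<lambda>t. c \<nu> * c \<mu> / 2 *
        (cos (of_int (int (k \<nu>) - int (k \<mu>)) * t) - cos (of_int (int (k \<nu>) + int (k \<mu>) + 1) * t)))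
        has_integral (if \<nu> = \<mu> then pi * (c \<nu>)\<^sup>2 else 0)) {-pi..pi}"
    if "\<nu> \<in> A" "\<mu> \<in> A" for \<nu> \<mu>
  proof -
    have "(int (k \<nu>) - int (k \<mu>) = 0) = (\<nu> = \<mu>)" using that assms(2) by (auto dest: inj_onD)
    moreover have "int (k \<nu>) + int (k \<mu>) + 1 \<noteq> 0" by linarith
    ultimately have "c \<nu> * c \<mu> / 2 * ((if int (k \<nu>) - int (k \<mu>) = 0 then 2 * pi else 0)
        - (if int (k \<nu>) + int (k \<mu>) + 1 = 0 then 2 * pi else 0)) = (if \<nu> = \<mu> then pi * (c \<nu>)\<^sup>2 else 0)"
      by (simp only: if_False) (simp add: power2_eq_square)
    then show ?thesis
      using has_integral_mult_right[OF has_integral_diff[OF integral_cos_multiple[of "int (k \<nu>) - int (k \<mu>)"]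
        integral_cos_multiple[of "int (k \<nu>) + int (k \<mu>) + 1"]], of "c \<nu> * c \<mu> / 2"]
      by (simp only:)
  qed
  have "((\<lambda>t. (\<Sum>\<nu>\<in>A. c \<nu> * sin ((real (k \<nu>) + 1 / 2) * t))\<^sup>2) has_integral
     (\<Sum>\<nu>\<in>A. \<Sum>\<mu>\<in>A. (if \<nu> = \<mu> then pi * (c \<nu>)\<^sup>2 else 0))) {-pi..pi}"
    unfolding e using assms i by (intro has_integral_sum) auto
  also have "(\<Sum>\<nu>\<in>A. \<Sum>\<mu>\<in>A. (if \<nu> = \<mu> then pi * (c \<nu>)\<^sup>2 else 0)) = pi * (\<Sum>\<nu>\<in>A. (c \<nu>)\<^sup>2)"
    using assms by (simp add: sum_distrib_left)
  finally show ?thesis .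
qed

subsection \<open>Estimates on a single zone\<close>

lemma borel_measurable_lebesgue_continuous:
  fixes f :: "real \<Rightarrow> real"
  shows "continuous_on UNIV f \<Longrightarrow> f \<in> borel_measurable lebesgue"
  by (simp add: borel_measurable_continuous_onI measurable_completion)

lemma set_integral_sum:
  fixes f :: "'i \<Rightarrow> 'a \<Rightarrow> real"
  assumes "\<And>i. i \<in> I \<Longrightarrow> set_integrable M Z (f i)"
  shows "set_integrable M Z (\<lambda>t. \<Sum>i\<in>I. f i t)"
    "(LINT t:Z|M. (\<Sum>i\<in>I. f i t)) = (\<Sum>i\<in>I. LINT t:Z|M. f i t)"
  using assms unfolding set_lebesgue_integral_def set_integrable_def scaleR_sum_right
  by (auto intro: Bochner_Integration.integral_sum)

lemma set_integral_abs_bound: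
  fixes f G :: "'a \<Rightarrow> real"
  assumes Z: "Z \<in> sets M" and f: "f \<in> borel_measurable M" and G: "set_integrable M Z G"
    and le: "\<And>t. t \<in> Z \<Longrightarrow> \<bar>f t\<bar> \<le> G t"
  shows "set_integrable M Z f" "\<bar>LINT t:Z|M. f t\<bar> \<le> (LINT t:Z|M. G t)"
proof -
  have sb: "set_borel_measurable M Z f"
    unfolding set_borel_measurable_def using Z f by measurable
  show int: "set_integrable M Z f"
    by (rule set_integrable_bound[OF G sb]) (use le in \<open>auto intro: order_trans[OF _ abs_ge_self]\<close>)
  have "\<bar>LINT t:Z|M. f t\<bar> \<le> (LINT t:Z|M. \<bar>f t\<bar>)"
    using set_integral_norm_bound[OF int] by simp
  also have "\<dots> \<le> (LINT t:Z|M. G t)"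
    using int G le by (intro set_integral_mono set_integrable_abs) auto
  finally show "\<bar>LINT t:Z|M. f t\<bar> \<le> (LINT t:Z|M. G t)" .
qed

lemma set_integral_const_lebesgue_le:
  assumes "Z \<in> sets lebesgue" "Z \<subseteq> {-H..H}" "0 \<le> H" "0 \<le> (c :: real)"
  shows "set_integrable lebesgue Z (\<lambda>t. c)" "(LINT t:Z|lebesgue. c) \<le> c * (2 * H)"
proof -
  have i: "set_integrable lebesgue {-H..H} (\<lambda>t. c)"
    by (intro absolutely_integrable_continuous_real) auto
  show iz: "set_integrable lebesgue Z (\<lambda>t. c)"
    by (rule set_integrable_subset[OF i]) (use assms in auto)
  have "(LINT t:Z|lebesgue. c) \<le> (LINT t:{-H..H}|lebesgue. c)"
    unfolding set_lebesgue_integral_def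
    by (rule integral_mono) (use i iz assms in \<open>auto simp: set_integrable_def indicator_def\<close>)
  also have "\<dots> = c * (2 * H)"
    using assms by (simp add: set_integral_Icc_eq_has_integral[OF _ has_integral_const_real])
  finally show "(LINT t:Z|lebesgue. c) \<le> c * (2 * H)" .
qed

text \<open>\<open>B\<close> bounds the local average of \<open>u\<close> in the exponent
  \<open>P\<close> at scale \<open>H\<close>, and \<open>c / H\<close> will be the size of the
  kernel on \<open>Z\<close>, so \<open>c * B\<close> is the natural size of an integral of
  \<open>u\<close> against the kernel.\<close>

locale zone =
  fixes Z :: "real set" and H B P c :: real and u :: "real \<Rightarrow> real"
  assumes Z: "Z \<in> sets lebesgue" "Z \<subseteq> {-H..H}" and H: "0 < H" and B: "0 < B" and P: "1 \<le> P"
    and u [measurable]: "u \<in> borel_measurable lebesgue"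
    and uP: "set_integrable lebesgue Z (\<lambda>t. \<bar>u t\<bar> powr P)"
    and uP_le: "(LINT t:Z|lebesgue. \<bar>u t\<bar> powr P) \<le> H * B powr P"
    and c: "0 < c"
begin

text \<open>Above the level \<open>B\<close>, write \<open>\<bar>u t\<bar>\<close> as
  \<open>\<bar>u t\<bar> powr (1 - P) * \<bar>u t\<bar> powr P\<close> and use
  \<open>1 - P \<le> 0\<close>. This pointwise form replaces Hoelder's inequality: integrated over
  \<open>Z\<close>, its terms give at most \<open>2 * H * B\<close> and \<open>H * B\<close>, the
  origin of the \<open>3\<close> in \<open>sup_bound\<close>.\<close>

lemma abs_le: "\<bar>u t\<bar> \<le> B + B powr (1 - P) * \<bar>u t\<bar> powr P"
proof (cases "\<bar>u t\<bar> \<le> B")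
  case False
  then have "B powr (P - 1) * \<bar>u t\<bar> \<le> \<bar>u t\<bar> powr (P - 1) * \<bar>u t\<bar>"
    using B P by (intro mult_right_mono powr_mono2) auto
  also have "\<dots> = \<bar>u t\<bar> powr P" using False B by (simp add: powr_diff)
  finally have "B powr (1 - P) * (B powr (P - 1) * \<bar>u t\<bar>) \<le> B powr (1 - P) * \<bar>u t\<bar> powr P"
    by (intro mult_left_mono) auto
  then have "\<bar>u t\<bar> \<le> B powr (1 - P) * \<bar>u t\<bar> powr P"
    using B by (simp add: mult.assoc[symmetric] powr_add[symmetric])
  then show ?thesis using B by linarith
qed (use B in \<open>simp add: add_increasing2\<close>)

lemma sup_bound:
  assumes D [measurable]: "D \<in> borel_measurable lebesgue" and D_le: "\<And>t. t \<in> Z \<Longrightarrow> \<bar>D t\<bar> \<le> c / H"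
  shows "set_integrable lebesgue Z (\<lambda>t. u t * D t)" "\<bar>LINT t:Z|lebesgue. u t * D t\<bar> \<le> 3 * c * B"
proof -
  let ?G = "\<lambda>t. c / H * (B + B powr (1 - P) * \<bar>u t\<bar> powr P)"
  note k = set_integral_const_lebesgue_le[OF Z less_imp_le[OF H] less_imp_le[OF B]]
  have iG: "set_integrable lebesgue Z ?G"
    using k(1) uP by (intro set_integrable_mult_right set_integral_add) auto
  have le: "\<bar>u t * D t\<bar> \<le> ?G t" if "t \<in> Z" for t
  proof -
    have "\<bar>D t\<bar> * \<bar>u t\<bar> \<le> ?G t"
      using D_le[OF that] abs_le[of t] c H by (intro mult_mono) auto
    then show ?thesis by (simp add: abs_mult mult.commute)
  qed
  have m: "(\<lambda>t. u t * D t) \<in> borel_measurable lebesgue" by measurable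
  note r = set_integral_abs_bound[OF Z(1) m iG le]
  show "set_integrable lebesgue Z (\<lambda>t. u t * D t)" by (rule r(1))
  have "(LINT t:Z|lebesgue. ?G t)
      = c / H * ((LINT t:Z|lebesgue. B) + B powr (1 - P) * (LINT t:Z|lebesgue. \<bar>u t\<bar> powr P))"
    using k(1) uP by (simp add: set_integral_add)
  also have "\<dots> \<le> c / H * (B * (2 * H) + B powr (1 - P) * (H * B powr P))"
    using c H k(2) uP_le by (intro mult_left_mono add_mono) auto
  also have "B powr (1 - P) * (H * B powr P) = H * B"
    using B by (simp add: mult.left_commute powr_add[symmetric])
  also have "c / H * (B * (2 * H) + H * B) = 3 * c * B"
    using H by (simp add: field_simps)
  finally show "\<bar>LINT t:Z|lebesgue. u t * D t\<bar> \<le> 3 * c * B" using r(2) by linarith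
qed

lemma sup_bound_sin:
  assumes K [measurable]: "K \<in> borel_measurable lebesgue" and K_le: "\<And>t. t \<in> Z \<Longrightarrow> \<bar>K t\<bar> \<le> c / H"
  shows "set_integrable lebesgue Z (\<lambda>t. u t * (K t * sin (a * t)))"
    "\<bar>LINT t:Z|lebesgue. u t * (K t * sin (a * t))\<bar> \<le> 3 * c * B"
proof -
  have [measurable]: "(\<lambda>t. sin (a * t)) \<in> borel_measurable lebesgue"
    by (intro borel_measurable_lebesgue_continuous continuous_intros)
  have "(\<lambda>t. K t * sin (a * t)) \<in> borel_measurable lebesgue" by measurable
  moreover have "\<bar>K t * sin (a * t)\<bar> \<le> c / H" if "t \<in> Z" for t
  proof -
    have "\<bar>K t * sin (a * t)\<bar> \<le> \<bar>K t\<bar>" by (simp add: abs_mult mult_left_le)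
    then show ?thesis using K_le[OF that] by linarith
  qed
  ultimately show "set_integrable lebesgue Z (\<lambda>t. u t * (K t * sin (a * t)))"
    "\<bar>LINT t:Z|lebesgue. u t * (K t * sin (a * t))\<bar> \<le> 3 * c * B"
    using sup_bound by blast+
qed

text \<open>Where \<open>\<bar>u t\<bar> \<le> B * M\<close>, the factor \<open>Q\<close> is estimated in mean square; elsewhere \<open>\<bar>u t\<bar>\<close> is at most
  \<open>(B * M) powr (1 - P) * \<bar>u t\<bar> powr P\<close> and \<open>Q\<close> is estimated by its supremum.\<close>

lemma truncation_bound:
  assumes D [measurable]: "D \<in> borel_measurable lebesgue" and D_le: "\<And>t. t \<in> Z \<Longrightarrow> \<bar>D t\<bar> \<le> c / H"
    and Q: "continuous_on UNIV Q" "\<And>t. \<bar>Q t\<bar> \<le> m * \<Phi>"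
    and Q2: "set_integrable lebesgue Z (\<lambda>t. (Q t)\<^sup>2)" "(LINT t:Z|lebesgue. (Q t)\<^sup>2) \<le> pi * \<Phi>\<^sup>2"
    and \<Phi>: "0 < \<Phi>" and M: "0 < M" and m: "0 < m"
  shows "\<bar>LINT t:Z|lebesgue. u t * D t * Q t\<bar> \<le> c * B * \<Phi> * (3 * M / sqrt H + M powr (1 - P) * m)"
proof -
  \<comment> \<open>Parameter of the inequality
    \<open>\<bar>Q\<bar> \<le> Q\<^sup>2 / (2 * \<tau>) + \<tau> / 2\<close>, used in place of
    Cauchy-Schwarz. As the integral of \<open>Q\<^sup>2\<close> is at most
    \<open>pi * \<Phi>\<^sup>2\<close> and \<open>Z\<close> has measure at most
    \<open>2 * H\<close>, this choice balances both terms at the order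
    \<open>\<Phi> * sqrt H\<close>.\<close>
  define \<tau> where "\<tau> = \<Phi> / sqrt H"
  have \<tau>: "\<tau> > 0" using \<Phi> H by (simp add: \<tau>_def)
  have [measurable]: "Q \<in> borel_measurable lebesgue"
    by (rule borel_measurable_lebesgue_continuous[OF Q(1)])
  let ?g1 = "\<lambda>t. (Q t)\<^sup>2 / (2 * \<tau>) + \<tau> / 2"
  let ?G = "\<lambda>t. c / H * (B * M * ?g1 t + ((B * M) powr (1 - P) * (m * \<Phi>)) * \<bar>u t\<bar> powr P)"
  have "0 \<le> \<tau> / 2" using \<tau> by simp
  note k = set_integral_const_lebesgue_le[OF Z less_imp_le[OF H] this]
  have ig1: "set_integrable lebesgue Z ?g1"
    using k(1) Q2(1) by (intro set_integral_add) auto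
  have iG: "set_integrable lebesgue Z ?G"
    by (rule set_integrable_mult_right[OF
          set_integral_add(1)[OF set_integrable_mult_right[OF ig1] set_integrable_mult_right[OF uP]]])
  have amgm: "\<bar>Q t\<bar> \<le> ?g1 t" for t
  proof -
    have "0 \<le> (\<bar>Q t\<bar> - \<tau>)\<^sup>2" by simp
    then show ?thesis using \<tau> by (simp add: power2_diff field_simps power2_eq_square)
  qed
  have le: "\<bar>u t * D t * Q t\<bar> \<le> ?G t" if "t \<in> Z" for t
  proof -
    have "\<bar>u t\<bar> * \<bar>Q t\<bar> \<le> B * M * \<bar>Q t\<bar> + ((B * M) powr (1 - P) * (m * \<Phi>)) * \<bar>u t\<bar> powr P"
    proof (cases "\<bar>u t\<bar> \<le> B * M")
      case True
      then have "\<bar>u t\<bar> * \<bar>Q t\<bar> \<le> B * M * \<bar>Q t\<bar>" by (intro mult_right_mono) auto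
      then show ?thesis using m \<Phi> by (smt (verit) mult_nonneg_nonneg powr_ge_zero)
    next
      case False
      have "0 < B * M" using B M by simp
      then have "\<bar>u t\<bar> powr (1 - P) \<le> (B * M) powr (1 - P)"
        using False P by (intro powr_mono2') auto
      then have "\<bar>u t\<bar> powr (1 - P) * \<bar>u t\<bar> powr P \<le> (B * M) powr (1 - P) * \<bar>u t\<bar> powr P"
        by (intro mult_right_mono) auto
      moreover have "\<bar>u t\<bar> powr (1 - P) * \<bar>u t\<bar> powr P = \<bar>u t\<bar>"
        using False \<open>0 < B * M\<close> by (simp add: powr_add[symmetric])
      ultimately have "\<bar>u t\<bar> * \<bar>Q t\<bar> \<le> ((B * M) powr (1 - P) * \<bar>u t\<bar> powr P) * (m * \<Phi>)"
        using Q(2)[of t] by (intro mult_mono) auto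
      moreover have "0 \<le> B * M * \<bar>Q t\<bar>" using B M by auto
      ultimately show ?thesis by (simp add: mult_ac)
    qed
    also have "\<dots> \<le> B * M * ?g1 t + ((B * M) powr (1 - P) * (m * \<Phi>)) * \<bar>u t\<bar> powr P"
      using amgm[of t] B M m \<Phi> by (intro add_mono mult_left_mono) auto
    finally have "\<bar>D t\<bar> * (\<bar>u t\<bar> * \<bar>Q t\<bar>) \<le> ?G t"
      using D_le[OF that] c H by (intro mult_mono) auto
    then show ?thesis by (simp add: abs_mult mult_ac)
  qed
  have ms: "(\<lambda>t. u t * D t * Q t) \<in> borel_measurable lebesgue" by measurable
  note r = set_integral_abs_bound[OF Z(1) ms iG le]
  have "(LINT t:Z|lebesgue. ?g1 t) = (LINT t:Z|lebesgue. (Q t)\<^sup>2) / (2 * \<tau>) + (LINT t:Z|lebesgue. \<tau> / 2)"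
    using k(1) Q2(1) by (subst set_integral_add) auto
  also have "\<dots> \<le> pi * \<Phi>\<^sup>2 / (2 * \<tau>) + \<tau> / 2 * (2 * H)"
    using Q2(2) k(2) \<tau> by (intro add_mono divide_right_mono) auto
  also have "\<dots> = (pi / 2 + 1) * (\<Phi> * sqrt H)"
  proof -
    have "pi * \<Phi>\<^sup>2 / (2 * (\<Phi> / h)) + \<Phi> / h / 2 * (2 * h\<^sup>2) = (pi / 2 + 1) * (\<Phi> * h)" if "h > 0" for h
      using that \<Phi> by (simp add: field_simps power2_eq_square)
    from this[of "sqrt H"] H show ?thesis by (simp add: \<tau>_def)
  qed
  also have "\<dots> \<le> 3 * (\<Phi> * sqrt H)"
    using pi_less_4 \<Phi> H by (intro mult_right_mono) auto
  finally have g1: "(LINT t:Z|lebesgue. ?g1 t) \<le> 3 * (\<Phi> * sqrt H)" .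
  have "(LINT t:Z|lebesgue. ?G t)
      = c / H * (B * M * (LINT t:Z|lebesgue. ?g1 t) + ((B * M) powr (1 - P) * (m * \<Phi>)) * (LINT t:Z|lebesgue. \<bar>u t\<bar> powr P))"
  proof -
    have "(LINT t:Z|lebesgue. ?G t) = c / H * (LINT t:Z|lebesgue. B * M * ?g1 t + ((B * M) powr (1 - P) * (m * \<Phi>)) * \<bar>u t\<bar> powr P)"
      by (rule set_integral_mult_right)
    also have "(LINT t:Z|lebesgue. B * M * ?g1 t + ((B * M) powr (1 - P) * (m * \<Phi>)) * \<bar>u t\<bar> powr P)
       = (LINT t:Z|lebesgue. B * M * ?g1 t) + (LINT t:Z|lebesgue. ((B * M) powr (1 - P) * (m * \<Phi>)) * \<bar>u t\<bar> powr P)"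
      by (rule set_integral_add(2)[OF set_integrable_mult_right[OF ig1] set_integrable_mult_right[OF uP]])
    finally show ?thesis by (simp only: set_integral_mult_right)
  qed
  also have "\<dots> \<le> c / H * (B * M * (3 * (\<Phi> * sqrt H)) + ((B * M) powr (1 - P) * (m * \<Phi>)) * (H * B powr P))"
    using c H g1 uP_le B M m \<Phi> by (intro mult_left_mono add_mono) auto
  also have "((B * M) powr (1 - P) * (m * \<Phi>)) * (H * B powr P) = (B powr (1 - P) * B powr P) * M powr (1 - P) * m * \<Phi> * H"
    using B M by (simp add: powr_mult)
  also have "B powr (1 - P) * B powr P = B" using B by (simp add: powr_add[symmetric])
  also have "c / H * (B * M * (3 * (\<Phi> * sqrt H)) + B * M powr (1 - P) * m * \<Phi> * H)
     = c * B * \<Phi> * (3 * M / sqrt H + M powr (1 - P) * m)"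
  proof -
    have "c / h\<^sup>2 * (B * M * (3 * (\<Phi> * h)) + B * M powr (1 - P) * m * \<Phi> * h\<^sup>2)
     = c * B * \<Phi> * (3 * M / h + M powr (1 - P) * m)" if "h > 0" for h
      using that by (simp add: field_simps power2_eq_square)
    from this[of "sqrt H"] H show ?thesis by simp
  qed
  finally show ?thesis using r(2) by linarith
qed

end

context zone
begin

text \<open>The square sum of the \<open>F \<nu>\<close> is itself the integral of \<open>u t * K t * Q t\<close> for the sine
  polynomial \<open>Q\<close> with coefficients \<open>F \<nu>\<close>; the truncation level \<open>M = X powr (1 / 4)\<close> makes both
  terms of \<open>truncation_bound\<close> decay in \<open>X\<close>.\<close>

lemma square_sum_bound:
  fixes k :: "'a \<Rightarrow> nat" and \<theta> :: real
  assumes K [measurable]: "K \<in> borel_measurable lebesgue" and K_le: "\<And>t. t \<in> Z \<Longrightarrow> \<bar>K t\<bar> \<le> c / H"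
    and Zpi: "Z \<subseteq> {-pi..pi}" and A: "finite A" "A \<noteq> {}" "inj_on k A"
    and F: "\<And>\<nu>. F \<nu> = (LINT t:Z|lebesgue. u t * (K t * sin ((real (k \<nu>) + 1 / 2) * t)))"
    and X: "X = real (card A) * H" "1 \<le> X" and \<theta>: "\<theta> \<le> 1 / 4" "\<theta> \<le> (P - 1) / 4"
  shows "(\<Sum>\<nu>\<in>A. (F \<nu>)\<^sup>2) \<le> real (card A) * (4 * c * B * X powr (- \<theta>))\<^sup>2"
proof (cases "(\<Sum>\<nu>\<in>A. (F \<nu>)\<^sup>2) = 0")
  case False
  define n where "n = real (card A)"
  have n: "n > 0" using A by (simp add: n_def card_gt_0_iff)
  define \<Phi> where "\<Phi> = sqrt (\<Sum>\<nu>\<in>A. (F \<nu>)\<^sup>2)"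
  have "(\<Sum>\<nu>\<in>A. (F \<nu>)\<^sup>2) \<ge> 0" by (intro sum_nonneg) auto
  with False have \<Phi>: "\<Phi> > 0" and \<Phi>2: "\<Phi>\<^sup>2 = (\<Sum>\<nu>\<in>A. (F \<nu>)\<^sup>2)"
    by (auto simp: \<Phi>_def)
  define Q where "Q = (\<lambda>t. \<Sum>\<nu>\<in>A. F \<nu> * sin ((real (k \<nu>) + 1 / 2) * t))"
  have Qc: "continuous_on S Q" for S unfolding Q_def by (intro continuous_intros)
  \<comment> \<open>Cauchy-Schwarz over the \<open>n\<close> coefficients; it supplies the supremum
    bound of \<open>truncation_bound\<close> with \<open>m = sqrt n\<close>.\<close>
  have Qb: "\<bar>Q t\<bar> \<le> sqrt n * \<Phi>" for t
  proof -
    have "\<bar>Q t\<bar> \<le> (\<Sum>\<nu>\<in>A. \<bar>F \<nu>\<bar> * 1)"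
      unfolding Q_def by (rule order_trans[OF sum_abs sum_mono]) (auto simp: abs_mult intro!: mult_left_le)
    also have "(\<Sum>\<nu>\<in>A. \<bar>F \<nu>\<bar> * 1)\<^sup>2 \<le> (\<Sum>\<nu>\<in>A. \<bar>F \<nu>\<bar>\<^sup>2) * (\<Sum>\<nu>\<in>A. 1\<^sup>2)"
      by (rule Cauchy_Schwarz_ineq_sum)
    then have "(\<Sum>\<nu>\<in>A. \<bar>F \<nu>\<bar> * 1) \<le> sqrt (n * \<Phi>\<^sup>2)"
      by (intro real_le_rsqrt) (simp add: \<Phi>2 n_def mult.commute)
    also have "\<dots> = sqrt n * \<Phi>" using \<Phi> by (simp add: real_sqrt_mult)
    finally show ?thesis .
  qed
  have i: "set_integrable lebesgue {-pi..pi} (\<lambda>t. (Q t)\<^sup>2)"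
    by (intro absolutely_integrable_continuous_real continuous_intros Qc)
  have Q2: "set_integrable lebesgue Z (\<lambda>t. (Q t)\<^sup>2)"
    by (rule set_integrable_subset[OF i Z(1) Zpi])
  have "(LINT t:Z|lebesgue. (Q t)\<^sup>2) \<le> (LINT t:{-pi..pi}|lebesgue. (Q t)\<^sup>2)"
    unfolding set_lebesgue_integral_def
    by (rule integral_mono) (use i Q2 Zpi in \<open>auto simp: set_integrable_def indicator_def\<close>)
  also have "\<dots> = pi * \<Phi>\<^sup>2"
    unfolding \<Phi>2 Q_def using A
    by (intro set_integral_Icc_eq_has_integral has_integral_sin_half_square continuous_intros) auto
  finally have Q2_le: "(LINT t:Z|lebesgue. (Q t)\<^sup>2) \<le> pi * \<Phi>\<^sup>2" .
  have ii: "set_integrable lebesgue Z (\<lambda>t. u t * (K t * sin ((real (k \<nu>) + 1 / 2) * t)))" for \<nu>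
    by (rule sup_bound_sin(1)[OF K K_le])
  have "\<Phi>\<^sup>2 = (\<Sum>\<nu>\<in>A. LINT t:Z|lebesgue. F \<nu> * (u t * (K t * sin ((real (k \<nu>) + 1 / 2) * t))))"
    unfolding \<Phi>2 by (intro sum.cong refl) (simp add: F power2_eq_square)
  also have "\<dots> = (LINT t:Z|lebesgue. (\<Sum>\<nu>\<in>A. F \<nu> * (u t * (K t * sin ((real (k \<nu>) + 1 / 2) * t)))))"
    using ii by (intro set_integral_sum(2)[symmetric] set_integrable_mult_right)
  also have "\<dots> = (LINT t:Z|lebesgue. u t * K t * Q t)"
    by (simp add: Q_def sum_distrib_left mult_ac)
  also have "\<dots> \<le> \<bar>LINT t:Z|lebesgue. u t * K t * Q t\<bar>" by simp
  \<comment> \<open>For a truncation level \<open>X powr a\<close> the two terms are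
    \<open>sqrt n\<close> times \<open>3 * X powr (a - 1 / 2)\<close> and
    \<open>X powr (- (a * (P - 1)))\<close>. For \<open>P > 1\<close> both exponents are negative
    when \<open>0 < a < 1 / 2\<close>; \<open>a = 1 / 4\<close> is a convenient choice.\<close>
  also have "\<dots> \<le> c * B * \<Phi> * (3 * X powr (1 / 4) / sqrt H + (X powr (1 / 4)) powr (1 - P) * sqrt n)"
    using X(2) n by (intro truncation_bound K K_le Qc Qb Q2 Q2_le \<Phi>) auto
  finally have "\<Phi> * \<Phi> \<le> \<Phi> * (c * B * (3 * X powr (1 / 4) / sqrt H + (X powr (1 / 4)) powr (1 - P) * sqrt n))"
    by (simp add: power2_eq_square mult_ac)
  \<comment> \<open>The left side is quadratic in \<open>\<Phi>\<close> and the right side linear;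
    cancelling one factor completes the duality argument.\<close>
  then have "\<Phi> \<le> c * B * (3 * X powr (1 / 4) / sqrt H + (X powr (1 / 4)) powr (1 - P) * sqrt n)"
    using \<Phi> by simp
  also have "\<dots> = sqrt n * (c * B * (3 * X powr (- (1 / 4)) + X powr (- ((P - 1) / 4))))"
  proof -
    have e: "X powr (1 / 4) / sqrt H = sqrt n * X powr (- (1 / 4))"
    proof -
      have "sqrt X = X powr (1 / 2)" using X by (simp add: powr_half_sqrt)
      then have "X powr (- (1 / 4)) = X powr (1 / 4) / sqrt X"
        by (simp add: powr_diff[symmetric])
      also have "sqrt X = sqrt n * sqrt H" by (simp add: X n_def real_sqrt_mult)
      finally show ?thesis using n by simp
    qed
    have "(X powr (1 / 4)) powr (1 - P) = X powr (- ((P - 1) / 4))"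
      unfolding powr_powr by (rule arg_cong[where f = "(powr) X"]) (simp add: field_simps)
    moreover have "3 * X powr (1 / 4) / sqrt H = 3 * (sqrt n * X powr (- (1 / 4)))"
      unfolding e[symmetric] by simp
    ultimately show ?thesis by (simp add: algebra_simps)
  qed
  also have "\<dots> \<le> sqrt n * (c * B * (3 * X powr (- \<theta>) + X powr (- \<theta>)))"
    using c B n X \<theta> by (intro mult_left_mono add_mono powr_mono) auto
  also have "\<dots> = sqrt n * (4 * c * B * X powr (- \<theta>))" by simp
  finally have "\<Phi>\<^sup>2 \<le> (sqrt n * (4 * c * B * X powr (- \<theta>)))\<^sup>2"
    using \<Phi> by (intro power_mono) auto
  then show ?thesis using n by (simp add: \<Phi>2 power_mult_distrib n_def)
qed auto

text \<open>Of the \<open>q\<close> powers, \<open>q - 2\<close> are spent on the uniform bound and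
  only the remaining square is improved by orthogonality; hence the decay exponent
  \<open>2 * \<theta>\<close> and not \<open>q * \<theta>\<close>. The uniform constant
  \<open>3\<close> is relaxed to \<open>4\<close> so that both bounds share one factor.\<close>

lemma powr_sum_bound:
  fixes k :: "'a \<Rightarrow> nat" and \<theta> :: real
  assumes K [measurable]: "K \<in> borel_measurable lebesgue" and K_le: "\<And>t. t \<in> Z \<Longrightarrow> \<bar>K t\<bar> \<le> c / H"
    and Zpi: "Z \<subseteq> {-pi..pi}" and A: "finite A" "A \<noteq> {}" "inj_on k A"
    and F: "\<And>\<nu>. F \<nu> = (LINT t:Z|lebesgue. u t * (K t * sin ((real (k \<nu>) + 1 / 2) * t)))"
    and X: "X = real (card A) * H" "1 \<le> X" and \<theta>: "\<theta> \<le> 1 / 4" "\<theta> \<le> (P - 1) / 4"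
    and q: "2 \<le> q"
  shows "(\<Sum>\<nu>\<in>A. \<bar>F \<nu>\<bar> powr q) \<le> real (card A) * (4 * c * B) powr q * X powr (- (2 * \<theta>))"
proof -
  have F3: "\<bar>F \<nu>\<bar> \<le> 4 * c * B" for \<nu>
  proof -
    have "\<bar>F \<nu>\<bar> \<le> 3 * c * B" unfolding F by (rule sup_bound_sin(2)[OF K K_le])
    also have "\<dots> \<le> 4 * c * B" using c B by simp
    finally show ?thesis .
  qed
  have "\<bar>F \<nu>\<bar> powr q \<le> (4 * c * B) powr (q - 2) * (F \<nu>)\<^sup>2" for \<nu>
  proof (cases "F \<nu> = 0")
    case False
    have "\<bar>F \<nu>\<bar> powr (q - 2) * (F \<nu>)\<^sup>2 \<le> (4 * c * B) powr (q - 2) * (F \<nu>)\<^sup>2"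
      using F3 q by (intro mult_right_mono powr_mono2) auto
    moreover have "\<bar>F \<nu>\<bar> powr q = \<bar>F \<nu>\<bar> powr (q - 2) * (F \<nu>)\<^sup>2"
      using False by (simp add: powr_diff powr_numeral)
    ultimately show ?thesis by simp
  qed auto
  then have "(\<Sum>\<nu>\<in>A. \<bar>F \<nu>\<bar> powr q) \<le> (\<Sum>\<nu>\<in>A. (4 * c * B) powr (q - 2) * (F \<nu>)\<^sup>2)"
    by (intro sum_mono)
  also have "\<dots> = (4 * c * B) powr (q - 2) * (\<Sum>\<nu>\<in>A. (F \<nu>)\<^sup>2)" by (simp add: sum_distrib_left)
  also have "\<dots> \<le> (4 * c * B) powr (q - 2) * (real (card A) * (4 * c * B * X powr (- \<theta>))\<^sup>2)"
    by (intro mult_left_mono square_sum_bound[OF K K_le Zpi A F X \<theta>]) auto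
  also have "(4 * c * B * X powr (- \<theta>))\<^sup>2 = (4 * c * B)\<^sup>2 * X powr (- (2 * \<theta>))"
    by (simp add: power_mult_distrib power2_eq_square powr_add[symmetric])
  also have "(4 * c * B) powr (q - 2) * (real (card A) * ((4 * c * B)\<^sup>2 * X powr (- (2 * \<theta>))))
     = real (card A) * ((4 * c * B) powr (q - 2) * (4 * c * B)\<^sup>2) * X powr (- (2 * \<theta>))" by simp
  also have "(4 * c * B) powr (q - 2) * (4 * c * B)\<^sup>2 = (4 * c * B) powr q"
    using c B by (simp add: powr_diff powr_numeral)
  finally show ?thesis .
qed

end

subsection \<open>Dyadic zones\<close>

definition zone_radius :: "nat \<Rightarrow> nat \<Rightarrow> real" where
  "zone_radius N j = pi * 2 ^ j / real N"

text \<open>Half-open shells, so that they are disjoint; zone \<open>0\<close> is a full interval on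
  which kernels of order below \<open>N\<close> are of size at most \<open>N\<close>. Restricting to
  one period makes all sufficiently distant shells empty.\<close>

definition zone_set :: "nat \<Rightarrow> nat \<Rightarrow> real set" where
  "zone_set N j = {t \<in> {-pi..pi}. \<bar>t\<bar> \<le> zone_radius N j \<and> (j > 0 \<longrightarrow> zone_radius N (j - 1) < \<bar>t\<bar>)}"

lemma zone_radius_pos: "N > 0 \<Longrightarrow> zone_radius N j > 0"
  by (simp add: zone_radius_def)

lemma zone_radius_Suc: "zone_radius N (Suc j) = 2 * zone_radius N j"
  by (simp add: zone_radius_def)

lemma zone_radius_mono: "i \<le> j \<Longrightarrow> zone_radius N i \<le> zone_radius N j"
  by (simp add: zone_radius_def divide_right_mono)

lemma zone_set_measurable [measurable]: "zone_set N j \<in> sets lebesgue"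
proof -
  have "zone_set N j \<in> sets borel" unfolding zone_set_def by measurable
  then show ?thesis by (simp add: sets_completionI_sets)
qed

lemma sum_zone_indicator:
  assumes "N > 0"
  shows "(\<Sum>j\<le>N. indicat_real (zone_set N j) t) = indicat_real {-pi..pi} t"
proof (cases "t \<in> {-pi..pi}")
  case True
  \<comment> \<open>Since \<open>N \<le> 2 ^ N\<close>, the zones up to index \<open>N\<close> cover
    the period. This is far more zones than necessary, which does no harm: the sum of the weights
    attached to them will be bounded independently of their number.\<close>
  have "pi \<le> zone_radius N N"
  proof -
    have "real N \<le> 2 ^ N" by (metis less_exp less_imp_le of_nat_le_numeral_power_cancel_iff)
    then show ?thesis using assms by (simp add: zone_radius_def field_simps)
  qed
  with True have ex: "\<bar>t\<bar> \<le> zone_radius N N" by auto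
  define i where "i = (LEAST j. \<bar>t\<bar> \<le> zone_radius N j)"
  have i: "\<bar>t\<bar> \<le> zone_radius N i" unfolding i_def by (rule LeastI, rule ex)
  have iN: "i \<le> N" unfolding i_def by (rule Least_le, rule ex)
  have less: "zone_radius N j < \<bar>t\<bar>" if "j < i" for j
    using not_less_Least[OF that[unfolded i_def]] by simp
  have "t \<in> zone_set N j \<longleftrightarrow> j = i" for j
  proof
    assume "t \<in> zone_set N j"
    then have j: "\<bar>t\<bar> \<le> zone_radius N j" "j > 0 \<Longrightarrow> zone_radius N (j - 1) < \<bar>t\<bar>"
      by (auto simp: zone_set_def)
    have "i \<le> j" using j(1) less[of j] by linarith
    moreover have "\<not> i < j"
    proof
      assume "i < j"
      then have "zone_radius N i \<le> zone_radius N (j - 1)" by (intro zone_radius_mono) auto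
      with j(2) i \<open>i < j\<close> show False by auto
    qed
    ultimately show "j = i" by simp
  next
    assume "j = i"
    then show "t \<in> zone_set N j" using True i less[of "i - 1"] by (auto simp: zone_set_def)
  qed
  then have "(\<Sum>j\<le>N. indicat_real (zone_set N j) t) = (\<Sum>j\<le>N. if j = i then 1 else 0)"
    by (intro sum.cong) (auto simp: indicator_def)
  then show ?thesis using iN True by simp
next
  case False
  then show ?thesis by (auto simp: zone_set_def indicator_def)
qed

text \<open>Points of zone \<open>j > 0\<close> satisfy
  \<open>\<bar>t\<bar> > zone_radius N j / 2\<close>; the factor \<open>2\<close> lost here is
  recovered from the denominator \<open>2 * sin (t / 2)\<close>, leaving the constant
  \<open>pi\<close>.\<close>

lemma zone_half_sin_bound:
  assumes "N > 0" "0 < j" "t \<in> zone_set N j"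
  shows "sin (t / 2) \<noteq> 0" "\<bar>1 / (2 * sin (t / 2))\<bar> \<le> pi / zone_radius N j"
proof -
  obtain i where j: "j = Suc i" using assms(2) by (cases j) auto
  have t: "\<bar>t\<bar> \<le> pi" "zone_radius N i < \<bar>t\<bar>" using assms(3) by (auto simp: zone_set_def j)
  note pos = zone_radius_pos[OF assms(1), of i]
  have "zone_radius N i / pi \<le> \<bar>t\<bar> / pi" using t by (intro divide_right_mono) auto
  also have "\<dots> \<le> \<bar>sin (t / 2)\<bar>" by (rule abs_sin_half_ge[OF t(1)])
  finally have s: "zone_radius N i / pi \<le> \<bar>sin (t / 2)\<bar>" .
  have p: "0 < zone_radius N i / pi" using pos by simp
  with s show "sin (t / 2) \<noteq> 0" by auto
  have "1 / \<bar>sin (t / 2)\<bar> \<le> 1 / (zone_radius N i / pi)"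
    using s p by (intro divide_left_mono mult_pos_pos) auto
  then show "\<bar>1 / (2 * sin (t / 2))\<bar> \<le> pi / zone_radius N j"
    by (simp add: j zone_radius_Suc abs_mult)
qed

lemma zone_dirichlet:
  assumes "N > 0" "0 < j" "t \<in> zone_set N j"
  shows "dirichlet k t = 1 / (2 * sin (t / 2)) * sin ((real k + 1 / 2) * t)"
  using sin_half_mult_dirichlet[of t k] zone_half_sin_bound(1)[OF assms] by (simp add: field_simps)

text \<open>On zone \<open>0\<close> the right side equals \<open>N\<close> and the trivial estimate
  of the kernel suffices, so the single constant \<open>c = pi\<close> serves every zone.\<close>

lemma zone_dirichlet_bound:
  assumes "k < N" "t \<in> zone_set N j"
  shows "\<bar>dirichlet k t\<bar> \<le> pi / zone_radius N j"
proof (cases "j = 0")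
  case True
  have "\<bar>dirichlet k t\<bar> \<le> real N" using abs_dirichlet_le[of k t] assms(1) by linarith
  then show ?thesis using assms(1) True by (simp add: zone_radius_def)
next
  case False
  have "\<bar>dirichlet k t\<bar> = \<bar>1 / (2 * sin (t / 2))\<bar> * \<bar>sin ((real k + 1 / 2) * t)\<bar>"
    using zone_dirichlet[of N j t k] assms False by (simp add: abs_mult)
  also have "\<dots> \<le> \<bar>1 / (2 * sin (t / 2))\<bar>" by (intro mult_left_le) auto
  also have "\<dots> \<le> pi / zone_radius N j" using zone_half_sin_bound(2)[of N j t] assms False by auto
  finally show ?thesis .
qed

text \<open>Doubling the radius doubles \<open>X\<close> in \<open>powr_sum_bound\<close>, which
  multiplies the bound for the sum of \<open>q\<close>-th powers by
  \<open>2 powr (- (2 * \<theta>))\<close> with \<open>\<theta> = min (1 / 4) ((P - 1) / 4)\<close>.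
  The ratio is the \<open>q\<close>-th root of this factor; for \<open>q > 0\<close> it is below
  \<open>1\<close> exactly when \<open>P > 1\<close>.\<close>

definition decay_ratio :: "real \<Rightarrow> real \<Rightarrow> real" where
  "decay_ratio P q = 2 powr (- (2 * min (1 / 4) ((P - 1) / 4) / q))"

definition zone_weight :: "real \<Rightarrow> nat \<Rightarrow> nat \<Rightarrow> real" where
  "zone_weight \<beta> j0 j = (if j < j0 then 1 else \<beta> ^ (j - j0))"

lemma decay_ratio_bounds:
  assumes "1 < P" "0 < q"
  shows "0 < decay_ratio P q" "decay_ratio P q < 1"
  using assms powr_less_mono[of "- (2 * min (1 / 4) ((P - 1) / 4) / q)" 0 2]
  by (auto simp: decay_ratio_def)

lemma zone_weight_pos: "0 < \<beta> \<Longrightarrow> 0 < zone_weight \<beta> j0 j"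
  by (simp add: zone_weight_def)

text \<open>The bound is free of \<open>n\<close>: only the \<open>j0\<close> unit weights
  accumulate, the others being dominated by the full geometric series.\<close>

lemma sum_zone_weight_le:
  assumes "0 < \<beta>" "\<beta> < 1"
  shows "(\<Sum>j\<le>n. zone_weight \<beta> j0 j) \<le> real j0 + 1 / (1 - \<beta>)"
proof -
  have "(\<Sum>j\<le>n. zone_weight \<beta> j0 j) \<le> (\<Sum>j\<in>{..<j0} \<union> {j0..j0+n}. zone_weight \<beta> j0 j)"
    using zone_weight_pos[OF assms(1)] by (intro sum_mono2) (auto simp: less_imp_le)
  also have "\<dots> = (\<Sum>j<j0. zone_weight \<beta> j0 j) + (\<Sum>j=j0..j0+n. zone_weight \<beta> j0 j)"
    by (intro sum.union_disjoint) auto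
  also have "(\<Sum>j<j0. zone_weight \<beta> j0 j) = real j0" by (simp add: zone_weight_def)
  also have "(\<Sum>j=j0..j0+n. zone_weight \<beta> j0 j) = (\<Sum>i\<le>n. \<beta> ^ i)"
    by (rule sum.reindex_bij_witness[of _ "\<lambda>i. i + j0" "\<lambda>j. j - j0"]) (auto simp: zone_weight_def)
  also have "\<dots> \<le> (\<Sum>i. \<beta> ^ i)"
    using assms by (intro sum_le_suminf summable_geometric) auto
  also have "\<dots> = 1 / (1 - \<beta>)" using assms by (intro suminf_geometric) auto
  finally show ?thesis by simp
qed

text \<open>\<open>j0\<close> is the first index with \<open>2 ^ j \<ge> N / (r + 1)\<close>; from
  there on \<open>(r + 1) * zone_radius N j\<close> is at least \<open>1\<close> and orthogonality
  gains. The zones are added by Minkowski's inequality in the \<open>q\<close>-norm over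
  \<open>\<nu>\<close>. The \<open>B j\<close> are left free because they will be local averages
  depending on the point \<open>x\<close>.\<close>

lemma dirichlet_strong_bound:
  fixes k :: "nat \<Rightarrow> nat" and r :: nat and u :: "real \<Rightarrow> real" and P q :: real
  defines "N \<equiv> Suc (k r)"
  defines "\<beta> \<equiv> decay_ratio P q"
  defines "j0 \<equiv> nat \<lceil>log 2 (real N / (real r + 1))\<rceil>"
  assumes P: "1 < P" and q: "2 \<le> q" and k: "strict_mono_on {0..r} k"
    and u [measurable]: "u \<in> borel_measurable lebesgue"
    and uP: "set_integrable lebesgue {-pi..pi} (\<lambda>t. \<bar>u t\<bar> powr P)"
    and Bpos: "\<And>j. j \<le> N \<Longrightarrow> 0 < B j"
    and le: "\<And>j. j \<le> N \<Longrightarrow> (LINT t:zone_set N j|lebesgue. \<bar>u t\<bar> powr P) \<le> zone_radius N j * B j powr P"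
  shows "(\<Sum>\<nu>=0..r. \<bar>LINT t:{-pi..pi}|lebesgue. u t * dirichlet (k \<nu>) t\<bar> powr q)
      \<le> (real r + 1) * (4 * pi * (\<Sum>j\<le>N. zone_weight \<beta> j0 j * B j)) powr q"
proof -
  have N: "N > 0" by (simp add: N_def)
  have \<beta>: "0 < \<beta>" using decay_ratio_bounds[of P q] P q by (simp add: \<beta>_def)
  define \<theta> where "\<theta> = min (1 / 4) ((P - 1) / 4)"
  have \<theta>: "\<theta> \<le> 1 / 4" "\<theta> \<le> (P - 1) / 4" "0 < \<theta>" using P unfolding \<theta>_def by (auto simp: min_def)
  have inj: "inj_on k {0..r}" using k by (rule strict_mono_on_imp_inj_on)
  have kN: "k \<nu> < N" if "\<nu> \<le> r" for \<nu>
    using strict_mono_on_leD[OF k, of \<nu> r] that by (auto simp: N_def)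
  define F where "F = (\<lambda>\<nu> j. LINT t:zone_set N j|lebesgue. u t * dirichlet (k \<nu>) t)"
  define w where "w = zone_weight \<beta> j0"
  have w: "w j > 0" for j using zone_weight_pos[OF \<beta>] by (simp add: w_def)
  have zone: "zone (zone_set N j) (zone_radius N j) (B j) P pi u" if j: "j \<le> N" for j
  proof
    show "zone_set N j \<subseteq> {- zone_radius N j..zone_radius N j}" by (auto simp: zone_set_def)
    show "set_integrable lebesgue (zone_set N j) (\<lambda>t. \<bar>u t\<bar> powr P)"
      by (rule set_integrable_subset[OF uP]) (auto simp: zone_set_def[of N j])
  qed (use P N zone_radius_pos Bpos[OF j] le[OF j] in auto)
  have Dm [measurable]: "dirichlet i \<in> borel_measurable lebesgue" for i
    by (intro borel_measurable_lebesgue_continuous continuous_intros)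
  have "(\<Sum>\<nu>=0..r. \<bar>\<Sum>j\<le>N. F \<nu> j\<bar> powr q) \<le> (\<Sum>j\<le>N. (real r + 1) powr (1 / q) * (4 * pi * (w j * B j))) powr q"
  proof (rule minkowski_sum)
    fix j assume "j \<in> {..N}"
    then have j: "j \<le> N" by simp
    interpret zone "zone_set N j" "zone_radius N j" "B j" P pi u by (rule zone[OF j])
    show "0 < (real r + 1) powr (1 / q) * (4 * pi * (w j * B j))"
      using Bpos[OF j] w by (simp add: add_pos_nonneg)
    have rhs: "((real r + 1) powr (1 / q) * (4 * pi * (w j * B j))) powr q = (real r + 1) * ((4 * pi * B j) powr q * w j powr q)"
      using q Bpos[OF j] w[of j] by (simp add: powr_mult powr_powr mult_ac)
    have "(\<Sum>\<nu>=0..r. \<bar>F \<nu> j\<bar> powr q) \<le> (real r + 1) * ((4 * pi * B j) powr q * w j powr q)"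
    \<comment> \<open>Zone \<open>0\<close> always falls under the first case, because
      \<open>1 / (2 * sin (t / 2))\<close> is unbounded near \<open>0\<close>. Its weight is
      \<open>1\<close> even when \<open>j0 = 0\<close>, being then
      \<open>\<beta> ^ 0\<close>.\<close>
    proof (cases "j < j0 \<or> j = 0")
      case True
      then have w1: "w j = 1" by (auto simp: w_def zone_weight_def)
      have "(\<Sum>\<nu>=0..r. \<bar>F \<nu> j\<bar> powr q) \<le> (\<Sum>\<nu>=0..r. (4 * pi * B j) powr q)"
      proof (rule sum_mono)
        fix \<nu> assume "\<nu> \<in> {0..r}"
        then have "\<bar>F \<nu> j\<bar> \<le> 3 * pi * B j"
          unfolding F_def by (intro sup_bound(2) zone_dirichlet_bound kN) auto
        also have "\<dots> \<le> 4 * pi * B j" using Bpos[OF j] by simp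
        finally show "\<bar>F \<nu> j\<bar> powr q \<le> (4 * pi * B j) powr q" using q by (intro powr_mono2) auto
      qed
      then show ?thesis by (simp add: w1 add.commute)
    next
      case False
      then have j0: "j0 \<le> j" "0 < j" by auto
      define X where "X = real (card {0..r}) * zone_radius N j"
      have "real N / (real r + 1) \<le> 2 ^ j0"
      proof -
        have "log 2 (real N / (real r + 1)) \<le> real j0"
          unfolding j0_def by linarith
        then have "real N / (real r + 1) \<le> 2 powr real j0"
          using N by (subst (asm) log_le_iff) auto
        then show ?thesis by (simp add: powr_realpow)
      qed
      then have "2 ^ (j - j0) * (real N / (real r + 1)) \<le> 2 ^ (j - j0) * 2 ^ j0" by (intro mult_left_mono) auto
      also have "\<dots> = 2 ^ j" using j0 by (simp add: power_add[symmetric])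
      finally have "2 ^ (j - j0) \<le> 2 ^ j * (real r + 1) / real N" using N by (simp add: field_simps)
      also have "\<dots> \<le> pi * (2 ^ j * (real r + 1) / real N)"
        using pi_ge_two mult_right_mono[of 1 pi "2 ^ j * (real r + 1) / real N"] by simp
      also have "\<dots> = X" by (simp add: X_def zone_radius_def)
      finally have X: "2 ^ (j - j0) \<le> X" .
      have X1: "1 \<le> X" by (rule order_trans[OF _ X]) simp
      have "(\<Sum>\<nu>=0..r. \<bar>F \<nu> j\<bar> powr q) \<le> real (card {0..r}) * (4 * pi * B j) powr q * X powr (- (2 * \<theta>))"
      proof (rule powr_sum_bound)
        show "(\<lambda>t::real. 1 / (2 * sin (t / 2))) \<in> borel_measurable lebesgue"
        proof -
          have [measurable]: "(\<lambda>t::real. sin (t / 2)) \<in> borel_measurable lebesgue"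
            by (intro borel_measurable_lebesgue_continuous continuous_intros) auto
          show ?thesis by measurable
        qed
        show "\<bar>1 / (2 * sin (t / 2))\<bar> \<le> pi / zone_radius N j" if "t \<in> zone_set N j" for t
          by (rule zone_half_sin_bound(2)[OF N j0(2) that])
        show "F \<nu> j = (LINT t:zone_set N j|lebesgue. u t * (1 / (2 * sin (t / 2)) * sin ((real (k \<nu>) + 1 / 2) * t)))" for \<nu>
          unfolding F_def
          by (intro set_lebesgue_integral_cong) (auto simp: zone_dirichlet[OF N j0(2)])
      qed (use inj X1 \<theta> q X_def in \<open>auto simp: zone_set_def\<close>)
      also have "\<dots> \<le> real (card {0..r}) * (4 * pi * B j) powr q * w j powr q"
      proof (intro mult_left_mono)
        have "X powr (- (2 * \<theta>)) \<le> (2 ^ (j - j0)) powr (- (2 * \<theta>))"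
          using X \<theta> by (intro powr_mono2') auto
        also have "\<dots> = w j powr q"
          using q False by (simp add: w_def zone_weight_def \<beta>_def decay_ratio_def \<theta>_def[symmetric]
              powr_realpow[symmetric] powr_powr mult_ac)
        finally show "X powr (- (2 * \<theta>)) \<le> w j powr q" .
      qed auto
      finally show ?thesis by (simp add: mult_ac add_ac)
    qed
    then show "(\<Sum>\<nu>=0..r. \<bar>F \<nu> j\<bar> powr q) \<le> ((real r + 1) powr (1 / q) * (4 * pi * (w j * B j))) powr q"
      by (simp add: rhs)
  qed (use q in auto)
  also have "(\<Sum>j\<le>N. (real r + 1) powr (1 / q) * (4 * pi * (w j * B j)))
      = (real r + 1) powr (1 / q) * (4 * pi * (\<Sum>j\<le>N. w j * B j))"
    by (simp add: sum_distrib_left)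
  also have "\<dots> powr q = (real r + 1) * (4 * pi * (\<Sum>j\<le>N. w j * B j)) powr q"
    using q by (simp add: powr_mult powr_powr)
  also have "(\<Sum>\<nu>=0..r. \<bar>\<Sum>j\<le>N. F \<nu> j\<bar> powr q)
     = (\<Sum>\<nu>=0..r. \<bar>LINT t:{-pi..pi}|lebesgue. u t * dirichlet (k \<nu>) t\<bar> powr q)"
  proof (intro sum.cong refl arg_cong[where f = "\<lambda>x. \<bar>x\<bar> powr q"])
    fix \<nu> assume "\<nu> \<in> {0..r}"
    then have \<nu>: "\<nu> \<le> r" by simp
    have i: "integrable lebesgue (\<lambda>t. indicat_real (zone_set N j) t *\<^sub>R (u t * dirichlet (k \<nu>) t))" if "j \<le> N" for j
      using zone.sup_bound(1)[OF zone[OF that] Dm zone_dirichlet_bound[OF kN[OF \<nu>]]]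
      unfolding set_integrable_def .
    have "(\<Sum>j\<le>N. F \<nu> j) = (LINT t|lebesgue. (\<Sum>j\<le>N. indicat_real (zone_set N j) t *\<^sub>R (u t * dirichlet (k \<nu>) t)))"
      unfolding F_def set_lebesgue_integral_def using i
      by (intro Bochner_Integration.integral_sum[symmetric]) auto
    also have "\<dots> = (LINT t:{-pi..pi}|lebesgue. u t * dirichlet (k \<nu>) t)"
      unfolding set_lebesgue_integral_def scaleR_sum_left[symmetric] sum_zone_indicator[OF N] ..
    finally show "(\<Sum>j\<le>N. F \<nu> j) = (LINT t:{-pi..pi}|lebesgue. u t * dirichlet (k \<nu>) t)" .
  qed
  finally show ?thesis by (simp add: w_def)
qed

subsection \<open>Translation of periodic functions\<close>

lemma borel_measurable_lebesgue_ident [measurable]: "(\<lambda>x::real. x) \<in> borel_measurable lebesgue"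
  by (rule measurable_completion) simp

lemma borel_measurable_lebesgue_shift:
  "f \<in> borel_measurable lebesgue \<Longrightarrow> (\<lambda>t. f (x + t :: real)) \<in> borel_measurable lebesgue"
  using measurable_compose[OF lebesgue_affine_measurable[where c = "\<lambda>_. 1::real" and t = x], of f borel]
  by simp

lemma nn_integral_shift_lebesgue:
  assumes "f \<in> borel_measurable lebesgue"
  shows "(\<integral>\<^sup>+t. f (x + t :: real) \<partial>lebesgue) = (\<integral>\<^sup>+t. f t \<partial>lebesgue)"
  using nn_integral_real_affine_lebesgue[OF assms, of 1 x] by simp

text \<open>For \<open>\<bar>x\<bar> \<le> pi\<close> the shifted interval meets only one
  neighbouring period; the part sticking out is moved back by \<open>2 * pi\<close>, and the
  mismatch at endpoints is a null set.\<close>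

lemma nn_integral_shift_period:
  fixes g :: "real \<Rightarrow> ennreal"
  assumes g [measurable]: "g \<in> borel_measurable lebesgue" and per: "\<And>t. g (t + 2 * pi) = g t"
    and x: "\<bar>x\<bar> \<le> pi"
  shows "(\<integral>\<^sup>+t\<in>{-pi..pi}. g (x + t) \<partial>lebesgue) = (\<integral>\<^sup>+t\<in>{-pi..pi}. g t \<partial>lebesgue)"
proof -
  have *: "(\<integral>\<^sup>+t\<in>{-pi..pi}. g (x + t) \<partial>lebesgue) = (\<integral>\<^sup>+t\<in>{-pi..pi}. g t \<partial>lebesgue)"
    if g [measurable]: "g \<in> borel_measurable lebesgue" and per: "\<And>t. g (t + 2 * pi) = g t"
      and x: "0 \<le> x" "x \<le> pi" for g :: "real \<Rightarrow> ennreal" and x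
  proof -
    have "(\<integral>\<^sup>+t\<in>{-pi..pi}. g (x + t) \<partial>lebesgue) = (\<integral>\<^sup>+t. g (x + t) * indicator {x-pi..x+pi} (x + t) \<partial>lebesgue)"
      by (intro nn_integral_cong) (auto simp: indicator_def)
    also have "\<dots> = (\<integral>\<^sup>+t. g t * indicator {x-pi..x+pi} t \<partial>lebesgue)"
      by (rule nn_integral_shift_lebesgue) measurable
    also have "\<dots> = (\<integral>\<^sup>+t. g t * indicator {x-pi..pi} t + g t * indicator {pi<..x+pi} t \<partial>lebesgue)"
      using x by (intro nn_integral_cong) (auto simp: indicator_def)
    also have "\<dots> = (\<integral>\<^sup>+t. g t * indicator {x-pi..pi} t \<partial>lebesgue) + (\<integral>\<^sup>+t. g t * indicator {pi<..x+pi} t \<partial>lebesgue)"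
      by (intro nn_integral_add) measurable
    also have "(\<integral>\<^sup>+t. g t * indicator {pi<..x+pi} t \<partial>lebesgue)
        = (\<integral>\<^sup>+t. g (2 * pi + t) * indicator {pi<..x+pi} (2 * pi + t) \<partial>lebesgue)"
      by (rule nn_integral_shift_lebesgue[symmetric]) measurable
    also have "\<dots> = (\<integral>\<^sup>+t. g t * indicator {-pi<..x-pi} t \<partial>lebesgue)"
      using per by (intro nn_integral_cong) (auto simp: indicator_def add.commute)
    also have "(\<integral>\<^sup>+t. g t * indicator {x-pi..pi} t \<partial>lebesgue) + \<dots>
        = (\<integral>\<^sup>+t. g t * indicator {x-pi..pi} t + g t * indicator {-pi<..x-pi} t \<partial>lebesgue)"
      by (intro nn_integral_add[symmetric]) measurable
    also have "\<dots> = (\<integral>\<^sup>+t\<in>{-pi..pi}. g t \<partial>lebesgue)"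
    proof (rule nn_integral_cong_AE)
      have "AE t in lebesgue. t \<noteq> -pi \<and> t \<noteq> x - pi"
        using AE_completion[OF AE_lborel_singleton[of "-pi"]] AE_completion[OF AE_lborel_singleton[of "x - pi"]]
        by eventually_elim auto
      then show "AE t in lebesgue. g t * indicator {x-pi..pi} t + g t * indicator {-pi<..x-pi} t
          = g t * indicator {-pi..pi} t"
        by eventually_elim (use x in \<open>auto simp: indicator_def\<close>)
    qed
    finally show ?thesis .
  qed
  show ?thesis
  proof (cases "x \<ge> 0")
    case True
    then show ?thesis using *[OF g per, of x] x by auto
  next
    case False
    \<comment> \<open>A negative shift is undone: the case already shown, applied to the translate
      of \<open>g\<close> by \<open>x\<close> with the shift \<open>- x\<close>, gives back
      \<open>g\<close>.\<close>
    have "(\<lambda>t. g (x + t)) \<in> borel_measurable lebesgue" by (rule borel_measurable_lebesgue_shift[OF g])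
    from *[OF this, of "-x"] False x per show ?thesis by (auto simp: add.assoc[symmetric])
  qed
qed

lemma set_integral_shift_period:
  fixes f :: "real \<Rightarrow> real"
  assumes f [measurable]: "f \<in> borel_measurable lebesgue" and per: "periodic_2pi f" and x: "\<bar>x\<bar> \<le> pi"
    and int: "set_integrable lebesgue {-pi..pi} f"
  shows "set_integrable lebesgue {-pi..pi} (\<lambda>t. f (x + t))"
    "(LINT t:{-pi..pi}|lebesgue. f (x + t)) = (LINT t:{-pi..pi}|lebesgue. f t)"
proof -
  have [measurable]: "(\<lambda>t. f (x + t)) \<in> borel_measurable lebesgue"
    by (rule borel_measurable_lebesgue_shift) measurable
  \<comment> \<open>The condition \<open>h 0 = 0\<close> lets the indicator be pulled out of
    \<open>h\<close>. Taking for \<open>h\<close> the norm gives integrability; the identity and the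
    negation give the positive and negative parts, since \<open>ennreal\<close> sends negative
    numbers to \<open>0\<close>.\<close>
  have e: "(\<integral>\<^sup>+t. ennreal (h (indicator {-pi..pi} t * f (x + t))) \<partial>lebesgue)
      = (\<integral>\<^sup>+t. ennreal (h (indicator {-pi..pi} t * f t)) \<partial>lebesgue)"
    if h: "h \<in> borel_measurable borel" "h 0 = 0" for h :: "real \<Rightarrow> real"
  proof -
    have i: "ennreal (h (indicator {-pi..pi} t * y)) = ennreal (h y) * indicator {-pi..pi} t" for t y :: real
      using h by (auto simp: indicator_def)
    have "(\<lambda>t. ennreal (h (f t))) \<in> borel_measurable lebesgue" using h by measurable
    from nn_integral_shift_period[OF this _ x] per show ?thesis
      unfolding i by (auto simp: periodic_2pi_def)
  qed
  have i2: "integrable lebesgue (\<lambda>t. indicator {-pi..pi} t * f t)" using int by (simp add: set_integrable_def)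
  have i1: "integrable lebesgue (\<lambda>t. indicator {-pi..pi} t * f (x + t))"
    unfolding integrable_iff_bounded
  proof
    show "(\<integral>\<^sup>+t. ennreal (norm (indicator {-pi..pi} t * f (x + t))) \<partial>lebesgue) < \<infinity>"
      using i2 unfolding integrable_iff_bounded by (subst e) auto
  qed measurable
  then show "set_integrable lebesgue {-pi..pi} (\<lambda>t. f (x + t))" by (simp add: set_integrable_def)
  show "(LINT t:{-pi..pi}|lebesgue. f (x + t)) = (LINT t:{-pi..pi}|lebesgue. f t)"
    unfolding set_lebesgue_integral_def real_scaleR_def
      real_lebesgue_integral_def[OF i1] real_lebesgue_integral_def[OF i2]
    using e[of "\<lambda>y. y"] e[of uminus] by simp
qed

text \<open>Fubini's theorem needs joint measurability of \<open>g (x + t)\<close>, so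
  \<open>g\<close> is first replaced by a Borel function \<open>g'\<close> equal to it almost
  everywhere. After the exchange, the inner integral runs over a translate of the period and no
  longer depends on \<open>t\<close>.\<close>

lemma nn_integral_convolution_period:
  fixes g :: "real \<Rightarrow> ennreal"
  assumes g [measurable]: "g \<in> borel_measurable lebesgue" and per: "\<And>t. g (t + 2 * pi) = g t"
    and Z [measurable]: "Z \<in> sets borel" and Zpi: "Z \<subseteq> {-pi..pi}"
  shows "(\<lambda>x. \<integral>\<^sup>+t\<in>Z. g (x + t) \<partial>lebesgue) \<in> borel_measurable lebesgue"
    "(\<integral>\<^sup>+x\<in>{-pi..pi}. (\<integral>\<^sup>+t\<in>Z. g (x + t) \<partial>lebesgue) \<partial>lebesgue)
      = emeasure lborel Z * (\<integral>\<^sup>+t\<in>{-pi..pi}. g t \<partial>lebesgue)"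
proof -
  obtain g' where g' [measurable]: "g' \<in> borel_measurable lborel" and ae: "AE x in lborel. g x = g' x"
    using completion_ex_borel_measurable[OF g] by auto
  have ae': "AE x in lebesgue. g x = g' x" by (rule AE_completion[OF ae])
  have [measurable]: "g' \<in> borel_measurable lebesgue" using g' by (rule measurable_completion)
  \<comment> \<open>The substitution \<open>s = x + t\<close> moves the shift from \<open>g\<close>
    to the indicator. Almost everywhere equality of \<open>g\<close> and \<open>g'\<close> then
    gives equal integrals for every \<open>x\<close>, not merely for almost every
    \<open>x\<close>.\<close>
  have eq: "(\<integral>\<^sup>+t. g (x + t) * indicator Y t \<partial>lebesgue) = (\<integral>\<^sup>+t. g' (x + t) * indicator Y t \<partial>lborel)"
    if Y [measurable]: "Y \<in> sets borel" for x and Y :: "real set"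
  proof -
    have [measurable]: "(\<lambda>s. indicator Y (- x + s) :: ennreal) \<in> borel_measurable lebesgue"
      by measurable
    have "(\<integral>\<^sup>+t. g (x + t) * indicator Y t \<partial>lebesgue) = (\<integral>\<^sup>+t. g (x + t) * indicator Y (- x + (x + t)) \<partial>lebesgue)"
      by simp
    also have "\<dots> = (\<integral>\<^sup>+s. g s * indicator Y (- x + s) \<partial>lebesgue)"
      by (rule nn_integral_shift_lebesgue) measurable
    also have "\<dots> = (\<integral>\<^sup>+s. g' s * indicator Y (- x + s) \<partial>lebesgue)"
      by (rule nn_integral_cong_AE) (use ae' in eventually_elim, simp)
    also have "\<dots> = (\<integral>\<^sup>+t. g' (x + t) * indicator Y (- x + (x + t)) \<partial>lebesgue)"
      by (rule nn_integral_shift_lebesgue[symmetric]) measurable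
    finally show ?thesis by (simp add: nn_integral_completion)
  qed
  have meas: "(\<lambda>x. \<integral>\<^sup>+t. g' (x + t) * indicator Z t \<partial>lborel) \<in> borel_measurable lborel"
    by measurable
  then show "(\<lambda>x. \<integral>\<^sup>+t\<in>Z. g (x + t) \<partial>lebesgue) \<in> borel_measurable lebesgue"
    unfolding eq[OF Z] by (rule measurable_completion)
  have "(\<integral>\<^sup>+x\<in>{-pi..pi}. (\<integral>\<^sup>+t\<in>Z. g (x + t) \<partial>lebesgue) \<partial>lebesgue)
      = (\<integral>\<^sup>+x. (\<integral>\<^sup>+t. g' (x + t) * indicator Z t * indicator {-pi..pi} x \<partial>lborel) \<partial>lborel)"
    unfolding eq[OF Z] unfolding nn_integral_completion by (subst nn_integral_multc) auto
  also have "\<dots> = (\<integral>\<^sup>+t. (\<integral>\<^sup>+x. g' (x + t) * indicator Z t * indicator {-pi..pi} x \<partial>lborel) \<partial>lborel)"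
    by (rule lborel_pair.Fubini') measurable
  also have "\<dots> = (\<integral>\<^sup>+t. (\<integral>\<^sup>+t\<in>{-pi..pi}. g t \<partial>lebesgue) * indicator Z t \<partial>lborel)"
  proof (rule nn_integral_cong)
    fix t
    have "(\<integral>\<^sup>+x. g' (x + t) * indicator Z t * indicator {-pi..pi} x \<partial>lborel)
        = (\<integral>\<^sup>+x. g' (t + x) * indicator {-pi..pi} x \<partial>lborel) * indicator Z t"
      by (subst nn_integral_multc[symmetric]) (auto simp: mult_ac add.commute)
    also have "\<dots> = (\<integral>\<^sup>+x\<in>{-pi..pi}. g (t + x) \<partial>lebesgue) * indicator Z t"
      by (subst eq) auto
    also have "\<dots> = (\<integral>\<^sup>+x\<in>{-pi..pi}. g x \<partial>lebesgue) * indicator Z t"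
    proof (cases "t \<in> Z")
      case True
      then have "t \<in> {-pi..pi}" using Zpi by blast
      then have "\<bar>t\<bar> \<le> pi" by auto
      from nn_integral_shift_period[OF g per this] show ?thesis by simp
    qed simp
    finally show "(\<integral>\<^sup>+x. g' (x + t) * indicator Z t * indicator {-pi..pi} x \<partial>lborel)
        = (\<integral>\<^sup>+x\<in>{-pi..pi}. g x \<partial>lebesgue) * indicator Z t" .
  qed
  also have "\<dots> = emeasure lborel Z * (\<integral>\<^sup>+t\<in>{-pi..pi}. g t \<partial>lebesgue)"
    by (subst nn_integral_cmult) (auto simp: mult.commute)
  finally show "(\<integral>\<^sup>+x\<in>{-pi..pi}. (\<integral>\<^sup>+t\<in>Z. g (x + t) \<partial>lebesgue) \<partial>lebesgue)
      = emeasure lborel Z * (\<integral>\<^sup>+t\<in>{-pi..pi}. g t \<partial>lebesgue)" .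
qed

subsection \<open>Dirichlet and Fejer kernels\<close>

lemma set_integrable_mult_continuous:
  fixes f h :: "real \<Rightarrow> real"
  assumes f [measurable]: "f \<in> borel_measurable lebesgue" and int: "set_integrable lebesgue {a..b} f"
    and h: "continuous_on UNIV h"
  shows "set_integrable lebesgue {a..b} (\<lambda>t. f t * h t)"
proof -
  have [measurable]: "h \<in> borel_measurable lebesgue" by (rule borel_measurable_lebesgue_continuous[OF h])
  have "bounded (h ` {a..b})"
    by (intro compact_imp_bounded compact_continuous_image continuous_on_subset[OF h]) auto
  then obtain M where M: "\<And>t. t \<in> {a..b} \<Longrightarrow> \<bar>h t\<bar> \<le> M"
    unfolding bounded_iff by (auto simp del: atLeastAtMost_iff)
  show ?thesis
  proof (rule set_integral_abs_bound(1))
    show "set_integrable lebesgue {a..b} (\<lambda>t. M * \<bar>f t\<bar>)"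
      using int by (intro set_integrable_mult_right set_integrable_abs)
    show "\<bar>f t * h t\<bar> \<le> M * \<bar>f t\<bar>" if "t \<in> {a..b}" for t
      using mult_right_mono[OF M[OF that], of "\<bar>f t\<bar>"] by (simp add: abs_mult mult.commute)
    show "(\<lambda>t. f t * h t) \<in> borel_measurable lebesgue" by measurable
  qed simp
qed

lemma dirichlet_periodic: "dirichlet k (t + 2 * pi) = dirichlet k t"
proof -
  have "cos (real j * (t + 2 * pi)) = cos (real j * t)" for j
    using cos_add[of "real j * t" "2 * pi * real j"] sin_integer_2pi[of "real j"] cos_integer_2pi[of "real j"]
    by (simp add: algebra_simps)
  then show ?thesis by (simp add: dirichlet_def)
qed

lemma fourier_partial_sum_kernel:
  assumes f [measurable]: "f \<in> borel_measurable lebesgue" and int: "set_integrable lebesgue {-pi..pi} f"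
  shows "fourier_partial_sum k f x = 1 / pi * (LINT t:{-pi..pi}|lebesgue. f t * dirichlet k (t - x))"
proof -
  note i = set_integrable_mult_continuous[OF f int]
  have ic: "set_integrable lebesgue {-pi..pi} (\<lambda>t. f t * cos (real j * t))" for j
    by (intro i continuous_intros)
  have isn: "set_integrable lebesgue {-pi..pi} (\<lambda>t. f t * sin (real j * t))" for j
    by (intro i continuous_intros)
  have e: "f t * dirichlet k (t - x) = f t * (1 / 2) +
      (\<Sum>j=1..k. f t * cos (real j * t) * cos (real j * x) + f t * sin (real j * t) * sin (real j * x))" for t
  proof -
    have "cos (real j * (t - x)) = cos (real j * t) * cos (real j * x) + sin (real j * t) * sin (real j * x)" for j
      by (simp add: right_diff_distrib cos_diff)
    then show ?thesis by (simp add: dirichlet_def algebra_simps sum_distrib_left)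
  qed
  have "(LINT t:{-pi..pi}|lebesgue. f t * dirichlet k (t - x)) =
      (LINT t:{-pi..pi}|lebesgue. f t * (1 / 2)) +
      (LINT t:{-pi..pi}|lebesgue. (\<Sum>j=1..k. f t * cos (real j * t) * cos (real j * x) + f t * sin (real j * t) * sin (real j * x)))"
    unfolding e
    by (intro set_integral_add set_integral_sum set_integrable_mult_left ic isn int)
  also have "(LINT t:{-pi..pi}|lebesgue. (\<Sum>j=1..k. f t * cos (real j * t) * cos (real j * x) + f t * sin (real j * t) * sin (real j * x)))
     = (\<Sum>j=1..k. LINT t:{-pi..pi}|lebesgue. f t * cos (real j * t) * cos (real j * x) + f t * sin (real j * t) * sin (real j * x))"
    by (intro set_integral_sum set_integral_add set_integrable_mult_left ic isn)
  also have "\<dots> = (\<Sum>j=1..k. (LINT t:{-pi..pi}|lebesgue. f t * cos (real j * t)) * cos (real j * x)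
      + (LINT t:{-pi..pi}|lebesgue. f t * sin (real j * t)) * sin (real j * x))"
    by (intro sum.cong refl, subst set_integral_add(2)[OF set_integrable_mult_left[OF ic] set_integrable_mult_left[OF isn]])
       simp
  finally show ?thesis
    by (simp add: fourier_partial_sum_def fourier_cos_def fourier_sin_def sum_distrib_left algebra_simps)
qed

lemma fourier_partial_sum_shift:
  assumes f [measurable]: "f \<in> borel_measurable lebesgue" and int: "set_integrable lebesgue {-pi..pi} f"
    and per: "periodic_2pi f" and x: "\<bar>x\<bar> \<le> pi"
  shows "fourier_partial_sum k f x = 1 / pi * (LINT t:{-pi..pi}|lebesgue. f (x + t) * dirichlet k t)"
proof -
  have [measurable]: "(\<lambda>t. dirichlet k (t - x)) \<in> borel_measurable lebesgue"
    by (intro borel_measurable_lebesgue_continuous continuous_intros)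
  have "periodic_2pi (\<lambda>t. f t * dirichlet k (t - x))"
    using per dirichlet_periodic[of k "_ - x"] by (simp add: periodic_2pi_def add_diff_eq diff_add_eq)
  then have "(LINT t:{-pi..pi}|lebesgue. f (x + t) * dirichlet k (x + t - x))
      = (LINT t:{-pi..pi}|lebesgue. f t * dirichlet k (t - x))"
    by (intro set_integral_shift_period x set_integrable_mult_continuous f int continuous_intros)
       measurable
  then show ?thesis by (simp add: fourier_partial_sum_kernel[OF f int])
qed

lemma set_integral_fold:
  fixes w :: "real \<Rightarrow> real"
  assumes w: "set_integrable lebesgue {-a..a} w" and a: "0 \<le> a"
  shows "set_integrable lebesgue {0..a} w" "set_integrable lebesgue {0..a} (\<lambda>t. w (- t))"
    "(LINT t:{-a..a}|lebesgue. w t) = (LINT t:{0..a}|lebesgue. w t + w (- t))"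
proof -
  have i1: "set_integrable lebesgue {-a..0} w" and i2: "set_integrable lebesgue {0..a} w"
    and i2': "set_integrable lebesgue {0<..a} w"
    by (rule set_integrable_subset[OF w]; use a in auto)+
  show "set_integrable lebesgue {0..a} w" by (rule i2)
  have e: "indicator {-a..0} (0 + -1 * t) *\<^sub>R w (0 + -1 * t) = indicator {0..a} t *\<^sub>R w (- t)" for t
    by (auto simp: indicator_def)
  have i3: "set_integrable lebesgue {0..a} (\<lambda>t. w (- t))"
    using lebesgue_integrable_real_affine[OF i1[unfolded set_integrable_def], of "-1" 0]
    unfolding e by (simp add: set_integrable_def)
  then show "set_integrable lebesgue {0..a} (\<lambda>t. w (- t))" .
  have r: "(LINT t:{-a..0}|lebesgue. w t) = (LINT t:{0..a}|lebesgue. w (- t))"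
    unfolding set_lebesgue_integral_def
    by (subst lebesgue_integral_real_affine[of "-1" _ 0], simp, subst e, simp)
  have "(LINT t:{-a..a}|lebesgue. w t) = (LINT t:{-a..0} \<union> {0<..a}|lebesgue. w t)"
    using a by (intro arg_cong[where f = "\<lambda>A. set_lebesgue_integral lebesgue A w"]) auto
  also have "\<dots> = (LINT t:{-a..0}|lebesgue. w t) + (LINT t:{0<..a}|lebesgue. w t)"
    by (rule set_integral_Un[OF _ i1 i2']) auto
  also have "(LINT t:{0<..a}|lebesgue. w t) = (LINT t:{0..a}|lebesgue. w t)"
    unfolding set_lebesgue_integral_def
  proof (rule integral_cong_AE)
    show "AE t in lebesgue. indicator {0<..a} t *\<^sub>R w t = indicator {0..a} t *\<^sub>R w t"
      using AE_completion[OF AE_lborel_singleton[of "0::real"]]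
      by eventually_elim (auto simp: indicator_def)
  qed (use i2 i2' in \<open>auto simp: set_integrable_def dest: borel_measurable_integrable\<close>)
  finally show "(LINT t:{-a..a}|lebesgue. w t) = (LINT t:{0..a}|lebesgue. w t + w (- t))"
    using i2 i3 by (simp add: r set_integral_add)
qed

lemma integral_dirichlet: "(LINT t:{0..pi}|lebesgue. dirichlet k t) = pi / 2"
proof -
  have c: "continuous_on {-pi..pi} (dirichlet k)" by (intro continuous_intros)
  have "((\<lambda>t. cos (real j * t)) has_integral 0) {-pi..pi}" if "j \<in> {1..k}" for j
    using integral_cos_multiple[of "int j"] that by auto
  moreover have "((\<lambda>t. 1 / 2) has_integral pi) {-pi..pi}"
    using has_integral_const_real[of "1/2::real" "-pi" pi] by simp
  ultimately have "((\<lambda>t. 1 / 2 + (\<Sum>j = 1..k. cos (real j * t))) has_integral pi + (\<Sum>j=1..k. 0)) {-pi..pi}"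
    by (intro has_integral_add has_integral_sum) auto
  then have "(dirichlet k has_integral pi) {-pi..pi}"
    unfolding dirichlet_def[abs_def] by simp
  then have "(LINT t:{-pi..pi}|lebesgue. dirichlet k t) = pi"
    by (rule set_integral_Icc_eq_has_integral[OF c])
  moreover have "(LINT t:{-pi..pi}|lebesgue. dirichlet k t) = (LINT t:{0..pi}|lebesgue. dirichlet k t + dirichlet k (- t))"
    by (intro set_integral_fold(3) absolutely_integrable_continuous_real c) auto
  ultimately have "(LINT t:{0..pi}|lebesgue. 2 * dirichlet k t) = pi" by simp
  then show ?thesis by simp
qed

lemma sym_diff2_integrable:
  assumes f [measurable]: "f \<in> borel_measurable lebesgue" and int: "set_integrable lebesgue {-pi..pi} f"
    and per: "periodic_2pi f" and x: "\<bar>x\<bar> \<le> pi"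
  shows "sym_diff2 f x \<in> borel_measurable lebesgue" "set_integrable lebesgue {0..pi} (sym_diff2 f x)"
proof -
  note sh = set_integral_shift_period(1)[OF f per x int]
  have m1 [measurable]: "(\<lambda>t. f (x + t)) \<in> borel_measurable lebesgue"
    by (rule borel_measurable_lebesgue_shift[OF f])
  have m2 [measurable]: "(\<lambda>t. f (x - t)) \<in> borel_measurable lebesgue"
    using measurable_compose[OF lebesgue_affine_measurable[where c = "\<lambda>_. -1::real" and t = x], of f borel]
    by simp
  show "sym_diff2 f x \<in> borel_measurable lebesgue"
    unfolding sym_diff2_def[abs_def] by measurable
  have "set_integrable lebesgue {0..pi} (\<lambda>t. 2 * f x)"
    by (intro absolutely_integrable_continuous_real continuous_intros)
  then show "set_integrable lebesgue {0..pi} (sym_diff2 f x)"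
    unfolding sym_diff2_def[abs_def] using set_integral_fold(1,2)[OF sh]
    by (intro set_integral_diff set_integral_add) auto
qed

text \<open>The kernel is even, so folding the interval pairs \<open>f (x + t)\<close> with
  \<open>f (x - t)\<close>; it integrates to \<open>pi / 2\<close> over the half period, so
  \<open>f x\<close> can be written under the integral as \<open>2 * f x\<close>. This produces the
  second difference that occurs in \<open>Gcirc\<close>.\<close>

lemma fourier_partial_sum_diff:
  assumes f [measurable]: "f \<in> borel_measurable lebesgue" and int: "set_integrable lebesgue {-pi..pi} f"
    and per: "periodic_2pi f" and x: "\<bar>x\<bar> \<le> pi"
  shows "fourier_partial_sum k f x - f x = 1 / pi * (LINT t:{0..pi}|lebesgue. sym_diff2 f x t * dirichlet k t)"
proof -
  have m1 [measurable]: "(\<lambda>t. f (x + t)) \<in> borel_measurable lebesgue"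
    by (rule borel_measurable_lebesgue_shift[OF f])
  have c: "continuous_on S (dirichlet k)" for S by (intro continuous_intros)
  have i: "set_integrable lebesgue {-pi..pi} (\<lambda>t. f (x + t) * dirichlet k t)"
    by (intro set_integrable_mult_continuous set_integral_shift_period f per x int m1 c)
  note fold = set_integral_fold[OF i, simplified]
  have ic: "set_integrable lebesgue {0..pi} (\<lambda>t. 2 * f x * dirichlet k t)"
    by (intro absolutely_integrable_continuous_real continuous_intros c)
  have "f x = 1 / pi * (LINT t:{0..pi}|lebesgue. 2 * f x * dirichlet k t)"
    by (simp add: integral_dirichlet)
  then have "fourier_partial_sum k f x - f x = 1 / pi *
     ((LINT t:{0..pi}|lebesgue. f (x + t) * dirichlet k t + f (x - t) * dirichlet k t) -
      (LINT t:{0..pi}|lebesgue. 2 * f x * dirichlet k t))"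
    unfolding right_diff_distrib using fourier_partial_sum_shift[OF f int per x] fold(3) by simp
  also have "(LINT t:{0..pi}|lebesgue. f (x + t) * dirichlet k t + f (x - t) * dirichlet k t) -
      (LINT t:{0..pi}|lebesgue. 2 * f x * dirichlet k t)
    = (LINT t:{0..pi}|lebesgue. (f (x + t) * dirichlet k t + f (x - t) * dirichlet k t) - 2 * f x * dirichlet k t)"
    using fold(1,2) ic by (intro set_integral_diff(2)[symmetric] set_integral_add(1)) auto
  finally show ?thesis by (simp add: sym_diff2_def algebra_simps)
qed

section \<open>The Fejer kernel and approximation by Fejer means\<close>

definition fejer :: "nat \<Rightarrow> real \<Rightarrow> real" where
  "fejer n t = 1 / (real n + 1) * (\<Sum>i=0..n. dirichlet i t)"

definition fejer_mean :: "nat \<Rightarrow> (real \<Rightarrow> real) \<Rightarrow> real \<Rightarrow> real" where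
  "fejer_mean n f x = 1 / (real n + 1) * (\<Sum>i=0..n. fourier_partial_sum i f x)"

text \<open>Each summand times \<open>4 * (sin (t / 2))\<^sup>2\<close> is a difference of
  consecutive cosines, so the sum telescopes. The bounded right side is the source of the quadratic
  decay of the kernel.\<close>

lemma sum_dirichlet: "4 * (sin (t / 2))\<^sup>2 * (\<Sum>i=0..n. dirichlet i t) = 1 - cos ((real n + 1) * t)"
proof (induction n)
  case 0
  show ?case using cos_double_sin[of "t / 2"] by (simp add: dirichlet_def)
next
  case (Suc n)
  have "4 * (sin (t / 2))\<^sup>2 * dirichlet (Suc n) t = 2 * sin (t / 2) * sin ((real (Suc n) + 1 / 2) * t)"
    unfolding sin_half_mult_dirichlet[symmetric] by (simp add: power2_eq_square)
  also have "\<dots> = cos ((real n + 1) * t) - cos ((real (Suc n) + 1) * t)"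
  proof -
    have "(real n + 1) * t = (real (Suc n) + 1 / 2) * t - t / 2"
      and "(real (Suc n) + 1) * t = (real (Suc n) + 1 / 2) * t + t / 2" by (simp_all add: field_simps)
    then show ?thesis by (simp only: cos_add cos_diff) simp
  qed
  finally show ?case using Suc by (simp add: algebra_simps)
qed

lemma abs_fejer_le: "\<bar>fejer n t\<bar> \<le> real n + 1"
proof -
  have "\<bar>\<Sum>i=0..n. dirichlet i t\<bar> \<le> (\<Sum>i=0..n. real n + 1)"
  proof (rule order_trans[OF sum_abs sum_mono])
    show "\<bar>dirichlet i t\<bar> \<le> real n + 1" if "i \<in> {0..n}" for i
      using abs_dirichlet_le[of i t] that by auto
  qed
  also have "\<dots> = (real n + 1) * (real n + 1)" by simp
  finally show ?thesis by (simp add: fejer_def abs_mult divide_le_eq)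
qed

lemma abs_fejer_le_decay:
  assumes "0 < t" "t \<le> pi"
  shows "\<bar>fejer n t\<bar> \<le> pi\<^sup>2 / (2 * (real n + 1) * t\<^sup>2)"
proof -
  have "t / pi \<le> \<bar>sin (t / 2)\<bar>" using abs_sin_half_ge[of t] assms by simp
  then have "(t / pi)\<^sup>2 \<le> (sin (t / 2))\<^sup>2" using assms by (subst abs_le_square_iff[symmetric]) auto
  then have "4 * (t / pi)\<^sup>2 * \<bar>\<Sum>i=0..n. dirichlet i t\<bar> \<le> 4 * (sin (t / 2))\<^sup>2 * \<bar>\<Sum>i=0..n. dirichlet i t\<bar>"
    by (intro mult_right_mono) auto
  also have "\<dots> = \<bar>1 - cos ((real n + 1) * t)\<bar>"
    unfolding sum_dirichlet[symmetric] by (simp add: abs_mult)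
  also have "\<dots> \<le> 2" by simp
  finally have "\<bar>\<Sum>i=0..n. dirichlet i t\<bar> \<le> pi\<^sup>2 / (2 * t\<^sup>2)"
    using assms by (simp add: field_simps)
  then have "\<bar>\<Sum>i=0..n. dirichlet i t\<bar> / (real n + 1) \<le> pi\<^sup>2 / (2 * t\<^sup>2) / (real n + 1)"
    by (intro divide_right_mono) auto
  also have "pi\<^sup>2 / (2 * t\<^sup>2) / (real n + 1) = pi\<^sup>2 / (2 * (real n + 1) * t\<^sup>2)"
    by (simp only: divide_divide_eq_left mult_ac)
  finally show ?thesis by (simp add: fejer_def abs_mult)
qed

text \<open>For \<open>m \<ge> 2\<close> the left endpoint is at least
  \<open>m / 2 * \<delta>\<close>, and inserting this in the quadratic decay gives the factor
  \<open>2\<close>; for \<open>m = 1\<close> the trivial bound is enough. The condition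
  \<open>m \<le> n + 1\<close> keeps the interval below \<open>pi\<close>.\<close>

lemma abs_fejer_le_interval:
  assumes m: "1 \<le> m" "m \<le> n + 1" and \<delta>: "\<delta> = pi / (real n + 1)"
    and t: "t \<in> {(real m - 1) * \<delta>..real m * \<delta>}"
  shows "\<bar>fejer n t\<bar> \<le> 2 * (real n + 1) / (real m)\<^sup>2"
proof (cases "m = 1")
  case True
  then show ?thesis using abs_fejer_le[of n t] by simp
next
  case False
  then have m2: "real m \<ge> 2" using m by simp
  have \<delta>0: "\<delta> > 0" using \<delta> by simp
  define y where "y = real m / 2 * \<delta>"
  have "y \<le> (real m - 1) * \<delta>" unfolding y_def using m2 \<delta>0 by (intro mult_right_mono) auto
  then have t1: "y \<le> t" using t by auto
  have p: "0 < y" using m2 \<delta>0 by (simp add: y_def)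
  have "t \<le> real m * \<delta>" using t by auto
  also have "\<dots> \<le> (real n + 1) * \<delta>" using m \<delta>0 by (intro mult_right_mono) auto
  also have "\<dots> = pi" by (simp add: \<delta>)
  finally have tpi: "t \<le> pi" .
  have "\<bar>fejer n t\<bar> \<le> pi\<^sup>2 / (2 * (real n + 1) * t\<^sup>2)"
    using abs_fejer_le_decay[of t n] p t1 tpi by linarith
  also have "\<dots> \<le> pi\<^sup>2 / (2 * (real n + 1) * y\<^sup>2)"
    using p t1 by (intro divide_left_mono mult_left_mono power_mono mult_pos_pos) auto
  also have "\<dots> = 2 * (real n + 1) / (real m)\<^sup>2"
  proof -
    have "pi\<^sup>2 / (2 * a * (M / 2 * (pi / a))\<^sup>2) = 2 * a / M\<^sup>2" if "a > 0" "M > 0" for a M :: real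
      using that by (simp add: power2_eq_square field_simps)
    from this[of "real n + 1" "real m"] m2 show ?thesis by (simp add: y_def \<delta>)
  qed
  finally show ?thesis .
qed

lemma sum_inverse_squares_le: "(\<Sum>m=1..n. 1 / (real m)\<^sup>2) \<le> 2"
proof -
  \<comment> \<open>The subtracted \<open>1 / n\<close> makes the induction close: the new term is
    at most the difference of consecutive reciprocals.\<close>
  have "(\<Sum>m=1..n. 1 / (real m)\<^sup>2) \<le> 2 - 1 / real n" if "n \<ge> 1" for n
    using that
  proof (induction n rule: nat_induct_at_least)
    case (Suc n)
    have "1 / (real (Suc n))\<^sup>2 \<le> 1 / (real n * real (Suc n))"
      unfolding power2_eq_square using Suc by (intro divide_left_mono mult_right_mono) auto
    also have "\<dots> = 1 / real n - 1 / real (Suc n)" using Suc by (simp add: field_simps)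
    finally have "1 / (real (Suc n))\<^sup>2 \<le> 1 / real n - 1 / real (Suc n)" .
    then show ?case using Suc by simp
  qed simp
  from this[of n] show ?thesis by (cases "n \<ge> 1") (auto intro: order_trans)
qed

text \<open>Hoelder's inequality, obtained from Young's after dividing by the \<open>s\<close>-norm
  \<open>G\<close>. Because \<open>q \<ge> 2\<close>, the powers \<open>(1 / m) powr q\<close> are
  dominated by inverse squares, so the constant \<open>3 = 1 + 2\<close> depends on neither
  \<open>q\<close> nor \<open>s\<close>.\<close>

lemma sum_over_index_le:
  fixes b :: "nat \<Rightarrow> real"
  assumes q: "2 \<le> q" and sq: "1 / s + 1 / q = 1" and b: "\<And>m. 0 \<le> b m"
  shows "(\<Sum>m=1..n. b m / real m) \<le> 3 * (\<Sum>m=1..n. b m powr s) powr (1 / s)"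
proof -
  define G where "G = (\<Sum>m=1..n. b m powr s) powr (1 / s)"
  have "1 / q \<le> 1 / 2" "1 / q > 0" using q by (auto intro: divide_left_mono)
  then have s1: "1 / 2 \<le> 1 / s" "1 / s < 1" using sq by linarith+
  then have s0: "s > 0" using zero_less_divide_1_iff[of s] by linarith
  with s1 have s: "1 < s" by (simp add: field_simps)
  have nn: "0 \<le> (\<Sum>m=1..n. b m powr s)" by (intro sum_nonneg) auto
  show ?thesis
  proof (cases "(\<Sum>m=1..n. b m powr s) = 0")
    case True
    then have "b m = 0" if "m \<in> {1..n}" for m using that by (subst (asm) sum_nonneg_eq_0_iff) auto
    then show ?thesis by simp
  next
    case False
    then have G: "G > 0" using nn by (simp add: G_def)
    have Gs: "G powr s = (\<Sum>m=1..n. b m powr s)" using nn s by (simp add: G_def powr_powr)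
    have "b m / real m \<le> G * (b m powr s / G powr s + 1 / (real m)\<^sup>2)" if m: "m \<in> {1..n}" for m
    proof -
      have "(b m / G) * (1 / real m) \<le> (b m / G) powr s / s + (1 / real m) powr q / q"
        using s q sq b G by (intro Youngs_inequality) auto
      also have "\<dots> \<le> (b m / G) powr s / 1 + (1 / real m) powr q / 1"
        using s q by (intro add_mono divide_left_mono) auto
      also have "(1 / real m) powr q \<le> (1 / real m) powr 2"
        using m q by (intro powr_mono') auto
      also have "(1 / real m) powr 2 = 1 / (real m)\<^sup>2"
        using m by (simp add: powr_numeral power_divide)
      finally have "(b m / G) * (1 / real m) \<le> b m powr s / G powr s + 1 / (real m)\<^sup>2"
        using b G by (simp add: powr_divide)
      from mult_left_mono[OF this less_imp_le[OF G]] show ?thesis using G by simp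
    qed
    then have "(\<Sum>m=1..n. b m / real m) \<le> (\<Sum>m=1..n. G * (b m powr s / G powr s + 1 / (real m)\<^sup>2))"
      by (intro sum_mono)
    also have "\<dots> = G * ((\<Sum>m=1..n. b m powr s) / G powr s + (\<Sum>m=1..n. 1 / (real m)\<^sup>2))"
      by (simp add: sum_distrib_left[symmetric] sum.distrib sum_divide_distrib)
    also have "(\<Sum>m=1..n. b m powr s) / G powr s = 1" using False Gs by simp
    also have "G * (1 + (\<Sum>m=1..n. 1 / (real m)\<^sup>2)) \<le> G * (1 + 2)"
      using G sum_inverse_squares_le[of n] by (intro mult_left_mono add_left_mono) auto
    finally show ?thesis by (simp add: G_def mult.commute)
  qed
qed

lemma fejer_mean_diff:
  assumes f [measurable]: "f \<in> borel_measurable lebesgue" and int: "set_integrable lebesgue {-pi..pi} f"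
    and per: "periodic_2pi f" and x: "\<bar>x\<bar> \<le> pi"
  shows "fejer_mean n f x - f x = 1 / pi * (LINT t:{0..pi}|lebesgue. sym_diff2 f x t * fejer n t)"
proof -
  note sd = sym_diff2_integrable[OF f int per x]
  have i: "set_integrable lebesgue {0..pi} (\<lambda>t. sym_diff2 f x t * dirichlet i t)" for i
    by (intro set_integrable_mult_continuous sd continuous_intros)
  have "fejer_mean n f x - f x = 1 / (real n + 1) * (\<Sum>i=0..n. fourier_partial_sum i f x - f x)"
    by (simp add: fejer_mean_def sum_subtractf field_simps)
  also have "\<dots> = 1 / (real n + 1) * (1 / pi * (\<Sum>i=0..n. LINT t:{0..pi}|lebesgue. sym_diff2 f x t * dirichlet i t))"
    by (simp only: fourier_partial_sum_diff[OF f int per x] sum_distrib_left)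
  also have "(\<Sum>i=0..n. LINT t:{0..pi}|lebesgue. sym_diff2 f x t * dirichlet i t)
      = (LINT t:{0..pi}|lebesgue. (\<Sum>i=0..n. sym_diff2 f x t * dirichlet i t))"
    by (intro set_integral_sum(2)[symmetric] i)
  also have "1 / (real n + 1) * (1 / pi * \<dots>) = 1 / pi * (LINT t:{0..pi}|lebesgue. 1 / (real n + 1) * (\<Sum>i=0..n. sym_diff2 f x t * dirichlet i t))"
    by (simp only: set_integral_mult_right mult_ac)
  finally show ?thesis by (simp add: fejer_def sum_distrib_left mult_ac)
qed

text \<open>With \<open>\<delta> = pi / (n + 1)\<close> the quotient \<open>pi / \<delta>\<close> is
  exactly the integer \<open>n + 1\<close>, so the intervals in \<open>Gcirc\<close> cover
  \<open>{0..pi}\<close> and match the kernel bound. The \<open>6\<close> is \<open>1 / pi\<close>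
  times \<open>2 * pi\<close> from that bound times \<open>3\<close> from
  \<open>sum_over_index_le\<close>.\<close>

lemma fejer_mean_le_Gcirc:
  assumes f [measurable]: "f \<in> borel_measurable lebesgue" and int: "set_integrable lebesgue {-pi..pi} f"
    and per: "periodic_2pi f" and x: "\<bar>x\<bar> \<le> pi"
    and q: "2 \<le> q" and sq: "1 / s + 1 / q = 1"
  shows "ennreal (\<bar>f x - fejer_mean n f x\<bar> / 6) \<le> Gcirc s f x (pi / (real n + 1))"
proof -
  define \<delta> where "\<delta> = pi / (real n + 1)"
  have \<delta>: "\<delta> > 0" by (simp add: \<delta>_def)
  have pid: "(real n + 1) * \<delta> = pi" by (simp add: \<delta>_def)
  note sd = sym_diff2_integrable[OF f int per x]
  note [measurable] = sd(1)
  define I where "I = (\<lambda>m::nat. {(real m - 1) * \<delta>..real m * \<delta>})"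
  define b where "b = (\<lambda>m. 1 / (real m * \<delta>) * (LINT t:I m|lebesgue. \<bar>sym_diff2 f x t\<bar>))"
  define w where "w = (\<lambda>t. sym_diff2 f x t * fejer n t)"
  have fc: "continuous_on S (fejer n)" for S unfolding fejer_def by (intro continuous_intros)
  have w: "set_integrable lebesgue {0..pi} w"
    unfolding w_def by (intro set_integrable_mult_continuous sd fc)
  have Isub: "I m \<subseteq> {0..pi}" if "m \<in> {1..n+1}" for m
  proof -
    have "0 \<le> (real m - 1) * \<delta>" using that \<delta> by auto
    moreover have "real m * \<delta> \<le> (real n + 1) * \<delta>" using that \<delta> by (intro mult_right_mono) auto
    ultimately show ?thesis by (auto simp: I_def pid)
  qed
  have wI: "set_integrable lebesgue (I m) w" and sI: "set_integrable lebesgue (I m) (sym_diff2 f x)"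
    if "m \<in> {1..n+1}" for m
    using Isub[OF that] by (auto intro: set_integrable_subset[OF w] set_integrable_subset[OF sd(2)] simp: I_def)
  have wIa: "integrable lebesgue (\<lambda>t. indicator (I m) t * \<bar>w t\<bar>)" if "m \<in> {1..n+1}" for m
    using set_integrable_abs[OF wI[OF that]] by (simp add: set_integrable_def)
  have nn: "0 \<le> (LINT t:A|lebesgue. \<bar>v t\<bar>)" for A and v :: "real \<Rightarrow> real"
    unfolding set_lebesgue_integral_def by (intro Bochner_Integration.integral_nonneg) auto
  have b0: "0 \<le> b m" for m using \<delta> nn by (simp add: b_def)
  \<comment> \<open>Neighbouring closed intervals share an endpoint; counting it twice only enlarges
    the right side, so an inequality of indicators is enough.\<close>
  have cover: "indicator {0..pi} t * \<bar>w t\<bar> \<le> (\<Sum>m=1..n+1. indicator (I m) t * \<bar>w t\<bar>)" for t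
  proof (cases "t \<in> {0..pi}")
    case True
    define m where "m = (if t = 0 then 1 else nat \<lceil>t / \<delta>\<rceil>)"
    have m: "m \<in> {1..n+1} \<and> t \<in> I m"
    proof (cases "t = 0")
      case False
      then have t0: "t > 0" using True by simp
      have "t / \<delta> \<le> (real n + 1)" using True \<delta> pid by (simp add: divide_le_eq)
      then have c1: "\<lceil>t / \<delta>\<rceil> \<le> int n + 1" by (simp add: ceiling_le_iff)
      have c2: "\<lceil>t / \<delta>\<rceil> \<ge> 1" using t0 \<delta> by simp
      have im: "int m = \<lceil>t / \<delta>\<rceil>" using False c2 by (simp add: m_def)
      then have rm: "real m = of_int \<lceil>t / \<delta>\<rceil>" by (metis of_int_of_nat_eq)
      have "real m - 1 \<le> t / \<delta>" "t / \<delta> \<le> real m" unfolding rm by linarith+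
      then have "t \<in> I m" using \<delta> by (auto simp: I_def field_simps)
      moreover have "1 \<le> m \<and> m \<le> n + 1" using c1 c2 unfolding im[symmetric] by linarith
      then have "m \<in> {1..n+1}" by simp
      ultimately show ?thesis by blast
    qed (use \<delta> in \<open>auto simp: m_def I_def\<close>)
    have "indicator {0..pi} t * \<bar>w t\<bar> = indicator (I m) t * \<bar>w t\<bar>" using True m by simp
    also have "\<dots> \<le> (\<Sum>m=1..n+1. indicator (I m) t * \<bar>w t\<bar>)"
      using m by (intro member_le_sum) auto
    finally show ?thesis .
  qed (auto intro!: sum_nonneg)
  have "\<bar>LINT t:{0..pi}|lebesgue. w t\<bar> \<le> (LINT t:{0..pi}|lebesgue. \<bar>w t\<bar>)"
    using set_integral_norm_bound[OF w] by simp
  also have "\<dots> \<le> (LINT t|lebesgue. (\<Sum>m=1..n+1. indicator (I m) t * \<bar>w t\<bar>))"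
    unfolding set_lebesgue_integral_def real_scaleR_def
  proof (rule integral_mono[OF _ _ cover])
    show "integrable lebesgue (\<lambda>t. indicator {0..pi} t * \<bar>w t\<bar>)"
      using set_integrable_abs[OF w] by (simp add: set_integrable_def)
    show "integrable lebesgue (\<lambda>t. \<Sum>m=1..n+1. indicator (I m) t * \<bar>w t\<bar>)"
      by (rule Bochner_Integration.integrable_sum) (rule wIa)
  qed
  also have "\<dots> = (\<Sum>m=1..n+1. LINT t:I m|lebesgue. \<bar>w t\<bar>)"
    unfolding set_lebesgue_integral_def real_scaleR_def
    by (rule Bochner_Integration.integral_sum) (rule wIa)
  also have "\<dots> \<le> (\<Sum>m=1..n+1. 2 * pi * (b m / real m))"
  proof (rule sum_mono)
    fix m assume m: "m \<in> {1..n+1}"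
    have "(LINT t:I m|lebesgue. \<bar>w t\<bar>) \<le> (LINT t:I m|lebesgue. 2 * (real n + 1) / (real m)\<^sup>2 * \<bar>sym_diff2 f x t\<bar>)"
    proof (rule set_integral_mono)
      show "\<bar>w t\<bar> \<le> 2 * (real n + 1) / (real m)\<^sup>2 * \<bar>sym_diff2 f x t\<bar>" if "t \<in> I m" for t
      proof -
        have "\<bar>fejer n t\<bar> \<le> 2 * (real n + 1) / (real m)\<^sup>2"
          using m that by (intro abs_fejer_le_interval[of m n \<delta>]) (auto simp: I_def \<delta>_def)
        from mult_right_mono[OF this, of "\<bar>sym_diff2 f x t\<bar>"] show ?thesis
          by (simp add: w_def abs_mult mult.commute)
      qed
    qed (use wI[OF m] sI[OF m] in \<open>auto intro!: set_integrable_mult_right set_integrable_abs\<close>)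
    also have "\<dots> = 2 * (real n + 1) / (real m)\<^sup>2 * (real m * \<delta> * b m)"
      using m \<delta> by (simp add: b_def)
    also have "\<dots> = 2 * ((real n + 1) * \<delta>) * (b m / real m)"
      using m by (simp add: power2_eq_square)
    finally show "(LINT t:I m|lebesgue. \<bar>w t\<bar>) \<le> 2 * pi * (b m / real m)" by (simp add: pid)
  qed
  also have "\<dots> = 2 * pi * (\<Sum>m=1..n+1. b m / real m)" by (rule sum_distrib_left[symmetric])
  also have "\<dots> \<le> 2 * pi * (3 * (\<Sum>m=1..n+1. b m powr s) powr (1 / s))"
    by (intro mult_left_mono sum_over_index_le[OF q sq b0]) auto
  finally have "\<bar>LINT t:{0..pi}|lebesgue. w t\<bar> \<le> 2 * pi * (3 * (\<Sum>m=1..n+1. b m powr s) powr (1 / s))" .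
  moreover have "\<bar>1 / pi * y\<bar> / 6 \<le> S" if "\<bar>y\<bar> \<le> 2 * pi * (3 * S)" for y S
    using that by (simp add: abs_mult divide_le_eq mult_ac)
  ultimately have "\<bar>1 / pi * (LINT t:{0..pi}|lebesgue. w t)\<bar> / 6 \<le> (\<Sum>m=1..n+1. b m powr s) powr (1 / s)"
    by blast
  then have le: "\<bar>f x - fejer_mean n f x\<bar> / 6 \<le> (\<Sum>m=1..n+1. b m powr s) powr (1 / s)"
    unfolding w_def fejer_mean_diff[OF f int per x, of n, symmetric] by (simp only: abs_minus_commute)
  have "nat \<lfloor>pi / \<delta>\<rfloor> = n + 1"
  proof -
    have "pi / \<delta> = of_int (int (n + 1))" using pid \<delta> by (simp add: field_simps)
    then show ?thesis by (simp only: floor_of_int nat_int)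
  qed
  then have "ennreal ((\<Sum>m=1..n+1. b m powr s) powr (1 / s)) \<le> Gcirc s f x \<delta>"
    unfolding Gcirc_def b_def I_def using \<delta> by (intro SUP_upper2[of \<delta>]) auto
  with le show ?thesis unfolding \<delta>_def by (meson ennreal_leI order_trans)
qed

lemma fourier_partial_sum_linear:
  assumes f [measurable]: "f \<in> borel_measurable lebesgue" "set_integrable lebesgue {-pi..pi} f"
    and g [measurable]: "g \<in> borel_measurable lebesgue" "set_integrable lebesgue {-pi..pi} g"
  shows "fourier_partial_sum k (\<lambda>t. a * f t + b * g t) x = a * fourier_partial_sum k f x + b * fourier_partial_sum k g x"
proof -
  have D: "continuous_on UNIV (\<lambda>t. dirichlet k (t - x))" by (intro continuous_intros)
  have i: "set_integrable lebesgue {-pi..pi} (\<lambda>t. a * (f t * dirichlet k (t - x)))"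
    "set_integrable lebesgue {-pi..pi} (\<lambda>t. b * (g t * dirichlet k (t - x)))"
    using f g D by (auto intro!: set_integrable_mult_right set_integrable_mult_continuous)
  have "set_integrable lebesgue {-pi..pi} (\<lambda>t. a * f t + b * g t)"
    using f g by (intro set_integral_add(1) set_integrable_mult_right) auto
  moreover have "(\<lambda>t. a * f t + b * g t) \<in> borel_measurable lebesgue" by measurable
  moreover have "(LINT t:{-pi..pi}|lebesgue. (a * f t + b * g t) * dirichlet k (t - x))
     = (LINT t:{-pi..pi}|lebesgue. a * (f t * dirichlet k (t - x)) + b * (g t * dirichlet k (t - x)))"
    by (simp add: algebra_simps)
  ultimately show ?thesis
    using f g by (simp add: fourier_partial_sum_kernel set_integral_add(2)[OF i] algebra_simps)
qed

subsection \<open>Trigonometric polynomials\<close>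

lemma integral_trig_products:
  fixes j l :: nat
  shows "(LINT t:{-pi..pi}|lebesgue. cos (real j * t) * cos (real l * t)) = (if j = l then if j = 0 then 2 * pi else pi else 0)"
    "(LINT t:{-pi..pi}|lebesgue. sin (real j * t) * sin (real l * t)) = (if j = l \<and> j \<noteq> 0 then pi else 0)"
    "(LINT t:{-pi..pi}|lebesgue. sin (real j * t) * cos (real l * t)) = 0"
proof -
  define d s where "d = int j - int l" and "s = int j + int l"
  have d: "real j * t - real l * t = of_int d * t" and s: "real j * t + real l * t = of_int s * t" for t
    by (simp_all add: d_def s_def algebra_simps)
  have d0: "d = 0 \<longleftrightarrow> j = l" and s0: "s = 0 \<longleftrightarrow> j = 0 \<and> l = 0" by (auto simp: d_def s_def)
  have "((\<lambda>t. cos (real j * t) * cos (real l * t)) has_integral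
      ((if d = 0 then 2 * pi else 0) + (if s = 0 then 2 * pi else 0)) / 2) {-pi..pi}"
    unfolding cos_times_cos d s by (intro has_integral_divide has_integral_add integral_cos_multiple)
  then have "(LINT t:{-pi..pi}|lebesgue. cos (real j * t) * cos (real l * t))
      = ((if d = 0 then 2 * pi else 0) + (if s = 0 then 2 * pi else 0)) / 2"
    by (intro set_integral_Icc_eq_has_integral continuous_intros)
  then show "(LINT t:{-pi..pi}|lebesgue. cos (real j * t) * cos (real l * t)) = (if j = l then if j = 0 then 2 * pi else pi else 0)"
    unfolding d0 s0 by (auto split: if_splits)
  have "((\<lambda>t. sin (real j * t) * sin (real l * t)) has_integral
      ((if d = 0 then 2 * pi else 0) - (if s = 0 then 2 * pi else 0)) / 2) {-pi..pi}"
    unfolding sin_times_sin d s by (intro has_integral_divide has_integral_diff integral_cos_multiple)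
  then have "(LINT t:{-pi..pi}|lebesgue. sin (real j * t) * sin (real l * t))
      = ((if d = 0 then 2 * pi else 0) - (if s = 0 then 2 * pi else 0)) / 2"
    by (intro set_integral_Icc_eq_has_integral continuous_intros)
  then show "(LINT t:{-pi..pi}|lebesgue. sin (real j * t) * sin (real l * t)) = (if j = l \<and> j \<noteq> 0 then pi else 0)"
    unfolding d0 s0 by (auto split: if_splits)
  have "((\<lambda>t. sin (real j * t) * cos (real l * t)) has_integral (0 + 0) / 2) {-pi..pi}"
    unfolding sin_times_cos d s by (intro has_integral_divide has_integral_add integral_sin_multiple)
  then show "(LINT t:{-pi..pi}|lebesgue. sin (real j * t) * cos (real l * t)) = 0"
    by (intro set_integral_Icc_eq_has_integral continuous_intros) simp
qed

text \<open>These are the trigonometric polynomials of degree at most \<open>k\<close>, described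
  through the property that the decomposition relies on and that passes directly to linear
  combinations.\<close>

definition reproduced :: "nat \<Rightarrow> (real \<Rightarrow> real) set" where
  "reproduced k = {h. continuous_on UNIV h \<and> periodic_2pi h \<and> (\<forall>x. fourier_partial_sum k h x = h x)}"

lemma cos_reproduced:
  assumes "j \<le> k"
  shows "(\<lambda>t. cos (real j * t)) \<in> reproduced k"
proof -
  have a: "fourier_cos (\<lambda>t. cos (real j * t)) l = (if j = l then if j = 0 then 2 else 1 else 0)" for l
    unfolding fourier_cos_def integral_trig_products by simp
  have b: "fourier_sin (\<lambda>t. cos (real j * t)) l = 0" for l
    unfolding fourier_sin_def using integral_trig_products(3)[of l j] by (simp add: mult.commute)
  have "fourier_partial_sum k (\<lambda>t. cos (real j * t)) x = cos (real j * x)" for x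
  proof -
    have "(\<Sum>l=1..k. fourier_cos (\<lambda>t. cos (real j * t)) l * cos (real l * x) + fourier_sin (\<lambda>t. cos (real j * t)) l * sin (real l * x))
      = (\<Sum>l=1..k. if j = l then cos (real l * x) else 0)"
      unfolding a b by (intro sum.cong) auto
    also have "\<dots> = (if j = 0 then 0 else cos (real j * x))" using assms by (simp add: sum.delta)
    finally show ?thesis unfolding fourier_partial_sum_def by (simp add: a)
  qed
  moreover have "cos (real j * (t + 2 * pi)) = cos (real j * t)" for t
    using cos_add[of "real j * t" "2 * pi * real j"] sin_integer_2pi[of "real j"] cos_integer_2pi[of "real j"]
    by (simp add: algebra_simps)
  ultimately show ?thesis by (auto simp: reproduced_def periodic_2pi_def intro!: continuous_intros)
qed

lemma sin_reproduced:
  assumes "j \<le> k"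
  shows "(\<lambda>t. sin (real j * t)) \<in> reproduced k"
proof -
  have a: "fourier_cos (\<lambda>t. sin (real j * t)) l = 0" for l
    unfolding fourier_cos_def integral_trig_products by simp
  have b: "fourier_sin (\<lambda>t. sin (real j * t)) l = (if j = l \<and> j \<noteq> 0 then 1 else 0)" for l
    unfolding fourier_sin_def integral_trig_products by simp
  have "fourier_partial_sum k (\<lambda>t. sin (real j * t)) x = sin (real j * x)" for x
  proof -
    have "(\<Sum>l=1..k. fourier_cos (\<lambda>t. sin (real j * t)) l * cos (real l * x) + fourier_sin (\<lambda>t. sin (real j * t)) l * sin (real l * x))
      = (\<Sum>l=1..k. if j = l then sin (real l * x) else 0)"
      unfolding a b by (intro sum.cong) auto
    also have "\<dots> = sin (real j * x)" using assms by (cases "j = 0") (auto simp: sum.delta)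
    finally show ?thesis unfolding fourier_partial_sum_def by (simp add: a)
  qed
  moreover have "sin (real j * (t + 2 * pi)) = sin (real j * t)" for t
    using sin_add[of "real j * t" "2 * pi * real j"] sin_integer_2pi[of "real j"] cos_integer_2pi[of "real j"]
    by (simp add: algebra_simps)
  ultimately show ?thesis by (auto simp: reproduced_def periodic_2pi_def intro!: continuous_intros)
qed

lemma reproducedD:
  assumes "h \<in> reproduced k"
  shows "continuous_on S h" "h \<in> borel_measurable lebesgue" "set_integrable lebesgue {a..b} h"
    "periodic_2pi h" "fourier_partial_sum k h x = h x"
  using assms unfolding reproduced_def
  by (auto intro: continuous_on_subset borel_measurable_lebesgue_continuous absolutely_integrable_continuous_real)

lemma linear_reproduced:
  assumes "g \<in> reproduced k" "h \<in> reproduced k"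
  shows "(\<lambda>t. a * g t + b * h t) \<in> reproduced k"
proof -
  have "fourier_partial_sum k (\<lambda>t. a * g t + b * h t) x = a * g x + b * h x" for x
    by (simp add: fourier_partial_sum_linear reproducedD[OF assms(1)] reproducedD[OF assms(2)])
  then show ?thesis
    using assms by (auto simp: reproduced_def periodic_2pi_def intro!: continuous_intros)
qed

lemma sum_reproduced:
  assumes "finite I" "\<And>i. i \<in> I \<Longrightarrow> h i \<in> reproduced k"
  shows "(\<lambda>t. \<Sum>i\<in>I. h i t) \<in> reproduced k"
  using assms
proof (induction I rule: finite_induct)
  case empty
  show ?case using linear_reproduced[OF cos_reproduced[of 0 k] cos_reproduced[of 0 k], of 0 0] by simp
next
  case (insert i I)
  then show ?case using linear_reproduced[of "h i" k "\<lambda>t. \<Sum>i\<in>I. h i t" 1 1] by simp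
qed

lemma fourier_partial_sum_reproduced:
  assumes "i \<le> k"
  shows "fourier_partial_sum i f \<in> reproduced k"
proof -
  have "(\<lambda>x. \<Sum>j=1..i. fourier_cos f j * cos (real j * x) + fourier_sin f j * sin (real j * x)) \<in> reproduced k"
    using assms by (intro sum_reproduced linear_reproduced cos_reproduced sin_reproduced) auto
  from linear_reproduced[OF cos_reproduced[of 0 k] this, of "fourier_cos f 0 / 2" 1]
  show ?thesis by (simp add: fourier_partial_sum_def[abs_def])
qed

lemma fejer_mean_reproduced:
  assumes "n \<le> k"
  shows "fejer_mean n f \<in> reproduced k"
proof -
  have "(\<lambda>x. \<Sum>i=0..n. fourier_partial_sum i f x) \<in> reproduced k"
    using assms by (intro sum_reproduced fourier_partial_sum_reproduced) auto
  from linear_reproduced[OF this this, of "1 / (real n + 1)" 0]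
  show ?thesis by (simp add: fejer_mean_def[abs_def])
qed

lemma fourier_partial_sum_minus_reproduced:
  assumes "f \<in> borel_measurable lebesgue" "set_integrable lebesgue {-pi..pi} f" and h: "h \<in> reproduced k"
  shows "fourier_partial_sum k (\<lambda>t. f t - h t) x = fourier_partial_sum k f x - h x"
  using fourier_partial_sum_linear[OF assms(1,2) reproducedD(2,3)[OF h], of k 1 "-1" x]
  by (simp add: reproducedD(5)[OF h])

subsection \<open>The strong mean\<close>

text \<open>The zones bound the partial sums and \<open>A\<close> bounds the subtracted value
  \<open>g x\<close>. The factor \<open>4\<close> is the \<open>4 * pi\<close> of
  \<open>dirichlet_strong_bound\<close> divided by the \<open>pi\<close> of the kernel
  formula.\<close>

lemma strong_mean_pointwise_bound:
  fixes k :: "nat \<Rightarrow> nat" and r :: nat and g :: "real \<Rightarrow> real" and P q :: real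
  defines "N \<equiv> Suc (k r)"
  defines "w \<equiv> zone_weight (decay_ratio P q) (nat \<lceil>log 2 (real N / (real r + 1))\<rceil>)"
  assumes P: "1 < P" and q: "2 \<le> q" and q': "0 < q'" "q' \<le> q" and k: "strict_mono_on {0..r} k"
    and g [measurable]: "g \<in> borel_measurable lebesgue" and int: "set_integrable lebesgue {-pi..pi} g"
    and gP: "set_integrable lebesgue {-pi..pi} (\<lambda>t. \<bar>g t\<bar> powr P)"
    and per: "periodic_2pi g" and x: "\<bar>x\<bar> \<le> pi"
    and B: "\<And>j. j \<le> N \<Longrightarrow> 0 < B j"
    and le: "\<And>j. j \<le> N \<Longrightarrow> (LINT t:zone_set N j|lebesgue. \<bar>g (x + t)\<bar> powr P) \<le> zone_radius N j * B j powr P"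
    and A: "0 < A" "\<bar>g x\<bar> \<le> A"
  shows "strong_mean q' r k g x \<le> A + 4 * (\<Sum>j\<le>N. w j * B j)"
proof -
  define S where "S = 4 * (\<Sum>j\<le>N. w j * B j)"
  define R where "R = (real r + 1) powr (1 / q)"
  have R: "R > 0" by (simp add: R_def add_pos_nonneg)
  have Rq: "R powr q = real r + 1" using q by (simp add: R_def powr_powr)
  have \<beta>: "0 < decay_ratio P q" using decay_ratio_bounds[of P q] P q by simp
  have S: "S > 0"
    unfolding S_def w_def using B zone_weight_pos[OF \<beta>] by (intro mult_pos_pos sum_pos) auto
  have gs [measurable]: "(\<lambda>t. g (x + t)) \<in> borel_measurable lebesgue" by (rule borel_measurable_lebesgue_shift[OF g])
  have [measurable]: "(\<lambda>t. \<bar>g t\<bar> powr P) \<in> borel_measurable lebesgue" by measurable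
  have gPs: "set_integrable lebesgue {-pi..pi} (\<lambda>t. \<bar>g (x + t)\<bar> powr P)"
    using per by (intro set_integral_shift_period[where f = "\<lambda>t. \<bar>g t\<bar> powr P"] x gP) (auto simp: periodic_2pi_def)
  have "(\<Sum>\<nu>=0..r. \<bar>fourier_partial_sum (k \<nu>) g x\<bar> powr q)
     = (\<Sum>\<nu>=0..r. (1 / pi) powr q * \<bar>LINT t:{-pi..pi}|lebesgue. g (x + t) * dirichlet (k \<nu>) t\<bar> powr q)"
    by (simp only: fourier_partial_sum_shift[OF g int per x] abs_mult) (simp add: powr_mult[symmetric])
  also have "\<dots> = (1 / pi) powr q * (\<Sum>\<nu>=0..r. \<bar>LINT t:{-pi..pi}|lebesgue. g (x + t) * dirichlet (k \<nu>) t\<bar> powr q)"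
    by (simp add: sum_distrib_left)
  also have "\<dots> \<le> (1 / pi) powr q * ((real r + 1) * (4 * pi * (\<Sum>j\<le>N. w j * B j)) powr q)"
    unfolding w_def N_def
    by (intro mult_left_mono dirichlet_strong_bound[OF P q k gs gPs])
       (use B le in \<open>auto simp: N_def\<close>)
  also have "\<dots> = (R * S) powr q"
  proof -
    have "(1 / pi) powr q * ((real r + 1) * (4 * pi * (\<Sum>j\<le>N. w j * B j)) powr q)
        = R powr q * ((1 / pi) powr q * (pi * S) powr q)"
      by (simp add: Rq S_def mult_ac)
    also have "(1 / pi) powr q * (pi * S) powr q = S powr q"
      by (simp add: powr_mult[symmetric])
    finally show ?thesis by (simp add: powr_mult)
  qed
  finally have bS: "(\<Sum>\<nu>=0..r. \<bar>fourier_partial_sum (k \<nu>) g x\<bar> powr q) \<le> (R * S) powr q" .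
  have bA: "(\<Sum>\<nu>=0..r. \<bar>- g x\<bar> powr q) \<le> (R * A) powr q"
  proof -
    have "\<bar>g x\<bar> powr q \<le> A powr q" using A q by (intro powr_mono2) auto
    then show ?thesis using R A by (simp add: powr_mult Rq add.commute mult_left_mono)
  qed
  \<comment> \<open>The two terms of the difference are indexed by \<open>bool\<close>, which makes
    the triangle inequality an instance of \<open>minkowski_sum\<close>.\<close>
  have "(\<Sum>\<nu>=0..r. \<bar>\<Sum>b\<in>UNIV. if b then fourier_partial_sum (k \<nu>) g x else - g x\<bar> powr q)
     \<le> (\<Sum>b\<in>UNIV. if b then R * S else R * A) powr q"
    by (rule minkowski_sum) (use q R S A bS bA in \<open>auto split: if_splits\<close>)
  then have m: "(\<Sum>\<nu>=0..r. \<bar>fourier_partial_sum (k \<nu>) g x - g x\<bar> powr q) \<le> (R * (A + S)) powr q"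
    by (simp add: UNIV_bool algebra_simps)
  have "strong_mean q' r k g x \<le> (1 / real (card {0..r}) * (\<Sum>\<nu>=0..r. \<bar>fourier_partial_sum (k \<nu>) g x - g x\<bar> powr q)) powr (1 / q)"
    using powr_mean_mono[of "{0..r}" q' q "\<lambda>\<nu>. \<bar>fourier_partial_sum (k \<nu>) g x - g x\<bar>"] q'
    by (simp add: strong_mean_def add.commute)
  also have "\<dots> \<le> (1 / real (card {0..r}) * (R * (A + S)) powr q) powr (1 / q)"
    using m q by (intro powr_mono2 mult_left_mono mult_nonneg_nonneg sum_nonneg) auto
  also have "\<dots> = A + S"
    using R A S q by (simp add: powr_mult Rq add.commute powr_powr)
  finally show ?thesis by (simp add: S_def)
qed

text \<open>The value of the bound in \<open>strong_mean_pointwise_bound\<close> when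
  \<open>A\<close> and all \<open>B j\<close> are \<open>1\<close>; the leading \<open>1\<close>
  belongs to the term \<open>g x\<close>.\<close>

definition weight_total :: "real \<Rightarrow> real \<Rightarrow> nat \<Rightarrow> (nat \<Rightarrow> nat) \<Rightarrow> real" where
  "weight_total P q r k = 1 + 4 * (\<Sum>j\<le>Suc (k r).
     zone_weight (decay_ratio P q) (nat \<lceil>log 2 (real (Suc (k r)) / (real r + 1))\<rceil>) j)"

lemma weight_total_ge_1:
  assumes "1 < P" "0 < q"
  shows "1 \<le> weight_total P q r k"
  unfolding weight_total_def using zone_weight_pos[OF decay_ratio_bounds(1)[OF assms]]
  by (simp add: sum_nonneg less_imp_le)

lemma emeasure_zone_set_le: "emeasure lborel (zone_set N j) \<le> ennreal (2 * zone_radius N j)"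
proof -
  have "emeasure lborel (zone_set N j) \<le> emeasure lborel {- zone_radius N j..zone_radius N j}"
    by (intro emeasure_mono) (auto simp: zone_set_def)
  also have "\<dots> = ennreal (2 * zone_radius N j)"
    by (simp add: zone_radius_def)
  finally show ?thesis .
qed

text \<open>The pointwise bound is a sum with weights of total \<open>W\<close>. Jensen's inequality
  bounds its \<open>P\<close>-th power by \<open>W powr (P - 1)\<close> times a weighted sum of
  \<open>P\<close>-th powers; apart from the added \<open>c\<close>, these are
  \<open>\<bar>g x\<bar> powr P\<close> and local averages in the same exponent, so integration over
  \<open>x\<close> costs only a constant.\<close>

lemma strong_mean_Lp_bound:
  fixes k :: "nat \<Rightarrow> nat" and r :: nat and g :: "real \<Rightarrow> real" and P q :: real
  assumes P: "1 < P" and q: "2 \<le> q" and q': "0 < q'" "q' \<le> q" and k: "strict_mono_on {0..r} k"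
    and g [measurable]: "g \<in> borel_measurable lebesgue" and int: "set_integrable lebesgue {-pi..pi} g"
    and per: "periodic_2pi g" and E: "0 < E"
    and gE: "(\<integral>\<^sup>+x\<in>{-pi..pi}. ennreal (\<bar>g x\<bar> powr P) \<partial>lebesgue) \<le> ennreal (E powr P)"
  shows "(\<integral>\<^sup>+x\<in>{-pi..pi}. ennreal (strong_mean q' r k g x powr P) \<partial>lebesgue)
    \<le> ennreal (9 * (weight_total P q r k * E) powr P)"
proof -
  define N where "N = Suc (k r)"
  define w where "w = zone_weight (decay_ratio P q) (nat \<lceil>log 2 (real N / (real r + 1))\<rceil>)"
  define W where "W = weight_total P q r k"
  have N: "N > 0" by (simp add: N_def)
  have w: "w j > 0" for j
    using zone_weight_pos[OF decay_ratio_bounds(1)[of P q]] P q by (simp add: w_def)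
  have W_eq: "W = 1 + 4 * (\<Sum>j\<le>N. w j)" by (simp add: W_def weight_total_def w_def N_def)
  have W: "W \<ge> 1" unfolding W_def using weight_total_ge_1 P q by simp
  define G where "G = (\<lambda>x. ennreal (\<bar>g x\<bar> powr P))"
  have G [measurable]: "G \<in> borel_measurable lebesgue" unfolding G_def by measurable
  have Gper: "G (t + 2 * pi) = G t" for t using per by (simp add: G_def periodic_2pi_def)
  have gP: "set_integrable lebesgue {-pi..pi} (\<lambda>t. \<bar>g t\<bar> powr P)"
    unfolding set_integrable_def integrable_iff_bounded
  proof
    have "(\<integral>\<^sup>+x. ennreal (norm (indicat_real {-pi..pi} x *\<^sub>R \<bar>g x\<bar> powr P)) \<partial>lebesgue)
      = (\<integral>\<^sup>+x\<in>{-pi..pi}. G x \<partial>lebesgue)"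
      by (intro nn_integral_cong) (auto simp: G_def indicator_def)
    also have "\<dots> < \<infinity>" using gE by (auto simp: G_def le_less_trans)
    finally show "(\<integral>\<^sup>+x. ennreal (norm (indicat_real {-pi..pi} x *\<^sub>R \<bar>g x\<bar> powr P)) \<partial>lebesgue) < \<infinity>" .
  qed measurable
  define H where "H = zone_radius N"
  have H: "H j > 0" for j using zone_radius_pos[OF N] by (simp add: H_def)
  define V where "V = (\<lambda>x j. 1 / H j * (LINT t:zone_set N j|lebesgue. \<bar>g (x + t)\<bar> powr P))"
  have V: "0 \<le> V x j" and Vn: "ennreal (V x j) = ennreal (1 / H j) * (\<integral>\<^sup>+t\<in>zone_set N j. G (x + t) \<partial>lebesgue)"
    if x: "\<bar>x\<bar> \<le> pi" for x j
  proof -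
    have "set_integrable lebesgue {-pi..pi} (\<lambda>t. \<bar>g (x + t)\<bar> powr P)"
      using per by (intro set_integral_shift_period[where f = "\<lambda>t. \<bar>g t\<bar> powr P"] x gP) (auto simp: periodic_2pi_def)
    then have i: "set_integrable lebesgue (zone_set N j) (\<lambda>t. \<bar>g (x + t)\<bar> powr P)"
      by (rule set_integrable_subset) (auto simp: zone_set_def[of N j])
    have "ennreal (LINT t:zone_set N j|lebesgue. \<bar>g (x + t)\<bar> powr P)
        = (\<integral>\<^sup>+t. ennreal (indicator (zone_set N j) t * \<bar>g (x + t)\<bar> powr P) \<partial>lebesgue)"
      unfolding set_lebesgue_integral_def
      using i by (subst nn_integral_eq_integral) (auto simp: set_integrable_def)
    also have "\<dots> = (\<integral>\<^sup>+t\<in>zone_set N j. G (x + t) \<partial>lebesgue)"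
      by (intro nn_integral_cong) (auto simp: G_def indicator_def)
    finally have e: "ennreal (LINT t:zone_set N j|lebesgue. \<bar>g (x + t)\<bar> powr P) = (\<integral>\<^sup>+t\<in>zone_set N j. G (x + t) \<partial>lebesgue)" .
    have nn: "0 \<le> (LINT t:zone_set N j|lebesgue. \<bar>g (x + t)\<bar> powr P)"
      unfolding set_lebesgue_integral_def by (intro Bochner_Integration.integral_nonneg) auto
    show "0 \<le> V x j" using nn H[of j] by (simp add: V_def)
    show "ennreal (V x j) = ennreal (1 / H j) * (\<integral>\<^sup>+t\<in>zone_set N j. G (x + t) \<partial>lebesgue)"
      unfolding V_def e[symmetric] using nn H[of j] by (intro ennreal_mult) auto
  qed
  define c where "c = E powr P"
  have c: "c > 0" using E by (simp add: c_def)
  define Hn where "Hn = (\<lambda>x. ennreal (W powr (P - 1)) * (G x + ennreal c +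
      (\<Sum>j\<le>N. ennreal (4 * w j) * (ennreal (1 / H j) * (\<integral>\<^sup>+t\<in>zone_set N j. G (x + t) \<partial>lebesgue) + ennreal c))))"
  have pointwise: "ennreal (strong_mean q' r k g x powr P) \<le> Hn x" if x: "\<bar>x\<bar> \<le> pi" for x
  proof -
    define A where "A = (\<bar>g x\<bar> powr P + c) powr (1 / P)"
    \<comment> \<open>adding \<open>c\<close> keeps the local averages positive at the cost of a constant factor\<close>
    define B where "B = (\<lambda>j. (V x j + c) powr (1 / P))"
    have AP: "A powr P = \<bar>g x\<bar> powr P + c" using c P by (simp add: A_def powr_powr add_nonneg_nonneg)
    have BP: "B j powr P = V x j + c" for j using c P V[OF x, of j] by (simp add: B_def powr_powr)
    have A: "A > 0" using c by (simp add: A_def add_nonneg_pos less_imp_neq[symmetric])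
    have B: "B j > 0" for j using c V[OF x, of j] by (simp add: B_def)
    have gA: "\<bar>g x\<bar> \<le> A"
    proof -
      have "\<bar>g x\<bar> = (\<bar>g x\<bar> powr P) powr (1 / P)" using P by (simp add: powr_powr)
      also have "\<dots> \<le> A" unfolding A_def using c P by (intro powr_mono2) auto
      finally show ?thesis .
    qed
    have "strong_mean q' r k g x \<le> A + 4 * (\<Sum>j\<le>N. w j * B j)"
      unfolding w_def N_def
    proof (rule strong_mean_pointwise_bound[OF P q q' k g int gP per x _ _ A gA])
      fix j
      show "0 < B j" by (rule B)
      show "(LINT t:zone_set (Suc (k r)) j|lebesgue. \<bar>g (x + t)\<bar> powr P) \<le> zone_radius (Suc (k r)) j * B j powr P"
        unfolding BP V_def N_def[symmetric] H_def[symmetric] using H[of j] c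
        by (simp add: field_simps less_imp_le)
    qed
    \<comment> \<open>The term \<open>A\<close> is appended at the index \<open>Suc N\<close> with
      weight \<open>1\<close>, so that all the weights add up to \<open>W\<close>.\<close>
    also have "\<dots> = (\<Sum>j\<le>Suc N. (if j = Suc N then 1 else 4 * w j) * (if j = Suc N then A else B j))"
      by (simp add: sum_distrib_left mult_ac)
    finally have "strong_mean q' r k g x powr P
        \<le> (\<Sum>j\<le>Suc N. (if j = Suc N then 1 else 4 * w j) * (if j = Suc N then A else B j)) powr P"
      using P by (intro powr_mono2) (auto simp: strong_mean_def)
    also have "\<dots> \<le> (\<Sum>j\<le>Suc N. (if j = Suc N then 1 else 4 * w j)) powr (P - 1)
        * (\<Sum>j\<le>Suc N. (if j = Suc N then 1 else 4 * w j) * (if j = Suc N then A else B j) powr P)"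
      using P w A B by (intro weighted_powr_mean) (auto simp: less_imp_le)
    also have "(\<Sum>j\<le>Suc N. (if j = Suc N then 1 else 4 * w j)) = W"
      by (simp add: W_eq sum_distrib_left)
    also have "(\<Sum>j\<le>Suc N. (if j = Suc N then 1 else 4 * w j) * (if j = Suc N then A else B j) powr P)
        = \<bar>g x\<bar> powr P + c + (\<Sum>j\<le>N. 4 * w j * (V x j + c))"
      by (simp add: AP BP)
    finally have "strong_mean q' r k g x powr P
       \<le> W powr (P - 1) * (\<bar>g x\<bar> powr P + c + (\<Sum>j\<le>N. 4 * w j * (V x j + c)))" .
    then have "ennreal (strong_mean q' r k g x powr P)
       \<le> ennreal (W powr (P - 1) * (\<bar>g x\<bar> powr P + c + (\<Sum>j\<le>N. 4 * w j * (V x j + c))))"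
      by (rule ennreal_leI)
    also have "\<dots> = Hn x"
    proof -
      have nn: "0 \<le> (\<Sum>j\<le>N. 4 * w j * (V x j + c))"
        using w V[OF x] c by (intro sum_nonneg mult_nonneg_nonneg add_nonneg_nonneg) (auto simp: less_imp_le)
      have "ennreal (\<Sum>j\<le>N. 4 * w j * (V x j + c)) = (\<Sum>j\<le>N. ennreal (4 * w j * (V x j + c)))"
        using w V[OF x] c by (subst sum_ennreal) (auto simp: less_imp_le)
      also have "\<dots> = (\<Sum>j\<le>N. ennreal (4 * w j) * (ennreal (V x j) + ennreal c))"
        using w V[OF x] c by (intro sum.cong refl) (simp add: ennreal_mult' ennreal_plus less_imp_le)
      finally show ?thesis
        unfolding Hn_def G_def[symmetric] Vn[OF x, symmetric] using nn c
        by (simp add: ennreal_mult' ennreal_plus G_def)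
    qed
    finally show ?thesis .
  qed
  have conv: "(\<lambda>x. \<integral>\<^sup>+t\<in>zone_set N j. G (x + t) \<partial>lebesgue) \<in> borel_measurable lebesgue"
    "(\<integral>\<^sup>+x\<in>{-pi..pi}. (\<integral>\<^sup>+t\<in>zone_set N j. G (x + t) \<partial>lebesgue) \<partial>lebesgue)
      = emeasure lborel (zone_set N j) * (\<integral>\<^sup>+t\<in>{-pi..pi}. G t \<partial>lebesgue)" for j
  proof -
    have z: "zone_set N j \<in> sets borel" unfolding zone_set_def by measurable
    have zp: "zone_set N j \<subseteq> {-pi..pi}" by (auto simp: zone_set_def)
    show "(\<lambda>x. \<integral>\<^sup>+t\<in>zone_set N j. G (x + t) \<partial>lebesgue) \<in> borel_measurable lebesgue"
      "(\<integral>\<^sup>+x\<in>{-pi..pi}. (\<integral>\<^sup>+t\<in>zone_set N j. G (x + t) \<partial>lebesgue) \<partial>lebesgue)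
        = emeasure lborel (zone_set N j) * (\<integral>\<^sup>+t\<in>{-pi..pi}. G t \<partial>lebesgue)"
      by (rule nn_integral_convolution_period[OF G Gper z zp])+
  qed
  note [measurable] = conv(1)
  \<comment> \<open>The \<open>7\<close> rounds up \<open>2 * pi\<close>. Together with
    \<open>2 * c\<close> for the local average, each zone costs at most \<open>9 * c\<close>, and
    the term \<open>g x\<close> at most \<open>8 * c\<close>; hence the \<open>9\<close> in the
    conclusion.\<close>
  have const: "(\<integral>\<^sup>+x\<in>{-pi..pi}. ennreal c \<partial>lebesgue) \<le> ennreal (7 * c)"
  proof -
    have "(\<integral>\<^sup>+x\<in>{-pi..pi}. ennreal c \<partial>lebesgue) = ennreal c * ennreal (2 * pi)"
      by (simp add: nn_integral_cmult_indicator)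
    also have "\<dots> = ennreal (2 * pi * c)" using c by (simp add: ennreal_mult'[symmetric] mult_ac)
    also have "\<dots> \<le> ennreal (7 * c)"
      using c pi_less_4 pi_approx by (intro ennreal_leI mult_right_mono) auto
    finally show ?thesis .
  qed
  have zone: "(\<integral>\<^sup>+x\<in>{-pi..pi}. ennreal (1 / H j) * (\<integral>\<^sup>+t\<in>zone_set N j. G (x + t) \<partial>lebesgue) \<partial>lebesgue) \<le> ennreal (2 * c)" for j
  proof -
    have "(\<integral>\<^sup>+x\<in>{-pi..pi}. ennreal (1 / H j) * (\<integral>\<^sup>+t\<in>zone_set N j. G (x + t) \<partial>lebesgue) \<partial>lebesgue)
       = ennreal (1 / H j) * (\<integral>\<^sup>+x\<in>{-pi..pi}. (\<integral>\<^sup>+t\<in>zone_set N j. G (x + t) \<partial>lebesgue) \<partial>lebesgue)"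
      by (subst nn_integral_cmult[symmetric]) (auto simp: mult.assoc)
    also have "\<dots> \<le> ennreal (1 / H j) * (ennreal (2 * H j) * ennreal c)"
      unfolding conv(2) using emeasure_zone_set_le gE
      by (intro mult_left_mono mult_mono) (auto simp: H_def G_def c_def)
    also have "\<dots> = ennreal (2 * c)" using H[of j] c by (simp add: ennreal_mult'[symmetric])
    finally show ?thesis .
  qed
  have "(\<integral>\<^sup>+x\<in>{-pi..pi}. ennreal (strong_mean q' r k g x powr P) \<partial>lebesgue) \<le> (\<integral>\<^sup>+x\<in>{-pi..pi}. Hn x \<partial>lebesgue)"
    using pointwise by (intro nn_integral_mono) (auto simp: indicator_def)
  also have "\<dots> = ennreal (W powr (P - 1)) * ((\<integral>\<^sup>+x\<in>{-pi..pi}. G x \<partial>lebesgue) + (\<integral>\<^sup>+x\<in>{-pi..pi}. ennreal c \<partial>lebesgue) +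
      (\<Sum>j\<le>N. ennreal (4 * w j) * ((\<integral>\<^sup>+x\<in>{-pi..pi}. ennreal (1 / H j) * (\<integral>\<^sup>+t\<in>zone_set N j. G (x + t) \<partial>lebesgue) \<partial>lebesgue)
         + (\<integral>\<^sup>+x\<in>{-pi..pi}. ennreal c \<partial>lebesgue))))"
  proof -
    have "(\<integral>\<^sup>+x\<in>{-pi..pi}. Hn x \<partial>lebesgue) = (\<integral>\<^sup>+x. ennreal (W powr (P - 1)) * (G x * indicator {-pi..pi} x + ennreal c * indicator {-pi..pi} x +
      (\<Sum>j\<le>N. ennreal (4 * w j) * (ennreal (1 / H j) * (\<integral>\<^sup>+t\<in>zone_set N j. G (x + t) \<partial>lebesgue) * indicator {-pi..pi} x + ennreal c * indicator {-pi..pi} x))) \<partial>lebesgue)"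
      by (intro nn_integral_cong) (auto simp: Hn_def indicator_def)
    then show ?thesis
      by (simp add: nn_integral_cmult nn_integral_add nn_integral_sum)
  qed
  also have "\<dots> \<le> ennreal (W powr (P - 1)) * (ennreal c + ennreal (7 * c) +
      (\<Sum>j\<le>N. ennreal (4 * w j) * (ennreal (2 * c) + ennreal (7 * c))))"
    using gE zone const by (intro mult_left_mono add_mono sum_mono) (auto simp: G_def c_def)
  also have "\<dots> = ennreal (W powr (P - 1) * (c + 7 * c + (\<Sum>j\<le>N. 4 * w j * (2 * c + 7 * c))))"
  proof -
    have h: "0 \<le> 4 * w j * (2 * c + 7 * c)" for j using w[of j] c by simp
    have "ennreal (4 * w j) * (ennreal (2 * c) + ennreal (7 * c)) = ennreal (4 * w j * (2 * c + 7 * c))" for j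
    proof -
      have "ennreal (2 * c) + ennreal (7 * c) = ennreal (2 * c + 7 * c)"
        using c by (intro ennreal_plus[symmetric]) auto
      moreover have "ennreal (4 * w j * (2 * c + 7 * c)) = ennreal (4 * w j) * ennreal (2 * c + 7 * c)"
        using w[of j] c by (intro ennreal_mult) auto
      ultimately show ?thesis by simp
    qed
    then have "(\<Sum>j\<le>N. ennreal (4 * w j) * (ennreal (2 * c) + ennreal (7 * c))) = (\<Sum>j\<le>N. ennreal (4 * w j * (2 * c + 7 * c)))"
      by simp
    also have "\<dots> = ennreal (\<Sum>j\<le>N. 4 * w j * (2 * c + 7 * c))" by (rule sum_ennreal[OF h])
    finally have s: "(\<Sum>j\<le>N. ennreal (4 * w j) * (ennreal (2 * c) + ennreal (7 * c))) = ennreal (\<Sum>j\<le>N. 4 * w j * (2 * c + 7 * c))" .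
    have "0 \<le> (\<Sum>j\<le>N. 4 * w j * (2 * c + 7 * c))" by (intro sum_nonneg h)
    then show ?thesis
      unfolding s using c by (subst ennreal_mult') (auto simp: ennreal_plus[symmetric] simp del: ennreal_plus)
  qed
  also have "\<dots> \<le> ennreal (9 * (W * E) powr P)"
  proof (rule ennreal_leI)
    have "(\<Sum>j\<le>N. 4 * w j * (2 * c + 7 * c)) = (W - 1) * (9 * c)"
      by (simp add: W_eq sum_distrib_left sum_distrib_right mult_ac)
    then have "c + 7 * c + (\<Sum>j\<le>N. 4 * w j * (2 * c + 7 * c)) \<le> 9 * (W * c)"
      using c by (simp add: algebra_simps)
    then have "W powr (P - 1) * (c + 7 * c + (\<Sum>j\<le>N. 4 * w j * (2 * c + 7 * c))) \<le> W powr (P - 1) * (9 * (W * c))"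
      by (intro mult_left_mono) auto
    also have "\<dots> = 9 * (W powr P * c)" using W by (simp add: powr_diff)
    also have "\<dots> = 9 * (W * E) powr P" using W E by (simp add: c_def powr_mult)
    finally show "W powr (P - 1) * (c + 7 * c + (\<Sum>j\<le>N. 4 * w j * (2 * c + 7 * c))) \<le> 9 * (W * E) powr P" .
  qed
  finally show ?thesis by (simp add: W_def)
qed

text \<open>For continuous functions the exponent of the local averages is free above
  \<open>1\<close>, and \<open>2\<close> is taken. A zone has measure at most twice its radius, so
  the average of the square is at most \<open>2 * E\<^sup>2 \<le> (2 * E)\<^sup>2\<close>, and
  \<open>B j = 2 * E\<close> is admissible.\<close>

lemma strong_mean_sup_bound:
  fixes k :: "nat \<Rightarrow> nat" and r :: nat and g :: "real \<Rightarrow> real" and q :: real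
  assumes q: "2 \<le> q" and q': "0 < q'" "q' \<le> q" and k: "strict_mono_on {0..r} k"
    and g: "continuous_on UNIV g" and per: "periodic_2pi g" and E: "0 < E"
    and gE: "\<And>x. \<bar>x\<bar> \<le> pi \<Longrightarrow> \<bar>g x\<bar> \<le> E" and x: "\<bar>x\<bar> \<le> pi"
  shows "strong_mean q' r k g x \<le> 2 * weight_total 2 q r k * E"
proof -
  define N where "N = Suc (k r)"
  define w where "w = zone_weight (decay_ratio 2 q) (nat \<lceil>log 2 (real N / (real r + 1))\<rceil>)"
  have gm: "g \<in> borel_measurable lebesgue" by (rule borel_measurable_lebesgue_continuous[OF g])
  have gc: "continuous_on S g" for S using g by (rule continuous_on_subset) simp
  \<comment> \<open>The point \<open>x + t\<close> is within \<open>2 * pi\<close> of the origin, so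
    at most one period shift brings it to where \<open>gE\<close> applies.\<close>
  have gxt: "\<bar>g (x + t)\<bar> \<le> E" if "\<bar>t\<bar> \<le> pi" for t
  proof -
    have "g (x + t) = g (x + t - 2 * pi)" and "g (x + t) = g (x + t + 2 * pi)"
      using per[unfolded periodic_2pi_def, rule_format, of "x + t - 2 * pi"]
        per[unfolded periodic_2pi_def, rule_format, of "x + t"] by simp_all
    moreover have "\<bar>x + t\<bar> \<le> pi \<or> \<bar>x + t - 2 * pi\<bar> \<le> pi \<or> \<bar>x + t + 2 * pi\<bar> \<le> pi"
      using x that by linarith
    ultimately show ?thesis using gE by metis
  qed
  have "strong_mean q' r k g x \<le> E + 4 * (\<Sum>j\<le>N. w j * (2 * E))"
    unfolding w_def N_def
  proof (rule strong_mean_pointwise_bound[where P = 2])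
    fix j
    have "(LINT t:zone_set (Suc (k r)) j|lebesgue. \<bar>g (x + t)\<bar> powr 2) \<le> (LINT t:zone_set (Suc (k r)) j|lebesgue. E\<^sup>2)"
    proof (rule set_integral_mono)
      show "\<bar>g (x + t)\<bar> powr 2 \<le> E\<^sup>2" if "t \<in> zone_set (Suc (k r)) j" for t
      proof -
        have "\<bar>t\<bar> \<le> pi" using that by (auto simp: zone_set_def)
        from power_mono[OF gxt[OF this], of 2] show ?thesis by (simp add: powr_numeral)
      qed
      have "set_integrable lebesgue {-pi..pi} (\<lambda>t. \<bar>g (x + t)\<bar> powr 2)"
        by (simp add: powr_numeral)
           (intro absolutely_integrable_continuous_real continuous_intros continuous_on_compose2[OF g]; simp)
      then show "set_integrable lebesgue (zone_set (Suc (k r)) j) (\<lambda>t. \<bar>g (x + t)\<bar> powr 2)"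
        by (rule set_integrable_subset) (auto simp: zone_set_def[of _ j])
    qed (rule set_integral_const_lebesgue_le(1)[of _ pi], auto simp: zone_set_def)
    also have "\<dots> \<le> E\<^sup>2 * (2 * zone_radius (Suc (k r)) j)"
      using zone_radius_pos[of "Suc (k r)" j] by (intro set_integral_const_lebesgue_le(2)) (auto simp: zone_set_def)
    also have "\<dots> \<le> zone_radius (Suc (k r)) j * (2 * E) powr 2"
      using zone_radius_pos[of "Suc (k r)" j] E by (simp add: powr_numeral power_mult_distrib mult_ac)
    finally show "(LINT t:zone_set (Suc (k r)) j|lebesgue. \<bar>g (x + t)\<bar> powr 2) \<le> zone_radius (Suc (k r)) j * (2 * E) powr 2" .
  qed (use q q' k gm per x E gE in \<open>auto intro!: absolutely_integrable_continuous_real continuous_intros gc\<close>)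
  also have "\<dots> \<le> 2 * (1 + 4 * (\<Sum>j\<le>N. w j)) * E"
    using E by (simp add: sum_distrib_left sum_distrib_right algebra_simps)
  finally show ?thesis by (simp add: weight_total_def w_def N_def)
qed

text \<open>Strictly increasing natural numbers satisfy \<open>k r \<ge> r\<close>; the
  \<open>1 / 2\<close> in the denominator then keeps the argument strictly above \<open>1\<close>
  even when \<open>k r = r\<close>.\<close>

lemma log_arg_bounds:
  assumes "strict_mono_on {0..r} k"
  shows "1 < log_arg r k" "real (Suc (k r)) / (real r + 1) \<le> log_arg r k" "1 \<le> real (Suc (k r)) / (real r + 1)"
proof -
  have "i \<le> k i" if "i \<le> r" for i
    using that
  proof (induction i)
    case (Suc i)
    have "k i < k (Suc i)" using Suc.prems by (intro strict_mono_onD[OF assms]) auto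
    then show ?case using Suc by simp
  qed simp
  then have "r \<le> k r" by simp
  then have "real r \<le> real (k r)" by simp
  then show "1 < log_arg r k" "1 \<le> real (Suc (k r)) / (real r + 1)"
    by (simp_all add: log_arg_def field_simps)
  show "real (Suc (k r)) / (real r + 1) \<le> log_arg r k"
    unfolding log_arg_def by (intro frac_le) auto
qed

text \<open>The number of full zones is at most \<open>log 2 x + 1\<close>, and
  \<open>log 2 x \<le> 2 * ln x\<close> because \<open>ln 2 \<ge> 1 / 2\<close> and
  \<open>x \<ge> 1\<close>. The factor \<open>9\<close> generously covers the coefficient
  \<open>8\<close> of the logarithm and the constant \<open>5\<close>.\<close>

lemma weight_total_le:
  assumes k: "strict_mono_on {0..r} k" and P: "1 < P" and q: "0 < q"
  shows "weight_total P q r k \<le> (9 + 4 / (1 - decay_ratio P q)) * (1 + ln (log_arg r k))"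
proof -
  define x where "x = real (Suc (k r)) / (real r + 1)"
  note b = log_arg_bounds[OF k, folded x_def]
  note d = decay_ratio_bounds[OF P q]
  have "real (nat \<lceil>log 2 x\<rceil>) \<le> log 2 x + 1" using b(3) by simp
  also have "log 2 x \<le> 2 * ln x"
  proof -
    have "1 / 2 \<le> ln (2::real)" using ln2_ge_two_thirds by simp
    then have "1 / ln 2 \<le> (2::real)" by (simp add: divide_le_eq)
    from mult_left_mono[OF this, of "ln x"] b(3) show ?thesis by (simp add: log_def mult.commute)
  qed
  also have "ln x \<le> ln (log_arg r k)" using b by simp
  finally have j0: "real (nat \<lceil>log 2 x\<rceil>) \<le> 2 * ln (log_arg r k) + 1" by simp
  have l: "0 < ln (log_arg r k)" using b by simp
  have "weight_total P q r k \<le> 1 + 4 * (real (nat \<lceil>log 2 x\<rceil>) + 1 / (1 - decay_ratio P q))"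
    unfolding weight_total_def x_def by (intro add_left_mono mult_left_mono sum_zone_weight_le d) auto
  also have "\<dots> \<le> 1 + 4 * (2 * ln (log_arg r k) + 1 + 1 / (1 - decay_ratio P q))"
    using j0 by simp
  also have "\<dots> \<le> (9 + 4 / (1 - decay_ratio P q)) * (1 + ln (log_arg r k))"
  proof -
    have "1 + 4 * (2 * y + 1 + d) \<le> (9 + 4 * d) * (1 + y)" if "0 < y" "0 < d" for y d :: real
      using that by (simp add: algebra_simps)
    from this[OF l, of "1 / (1 - decay_ratio P q)"] d show ?thesis by simp
  qed
  finally show ?thesis .
qed

section \<open>Norms with values in \<open>[0, \<infinity>]\<close> and the final estimate\<close>

lemma epow_mono: "x \<le> y \<Longrightarrow> 0 \<le> a \<Longrightarrow> epow x a \<le> epow y a"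
  by (cases x rule: ennreal_cases; cases y rule: ennreal_cases)
     (auto simp: epow_def top_unique intro!: ennreal_leI powr_mono2)

lemma epow_ennreal: "0 \<le> x \<Longrightarrow> epow (ennreal x) a = ennreal (x powr a)"
  by (simp add: epow_def)

lemma epow_epow_inverse:
  assumes "0 < a"
  shows "epow (epow x (1 / a)) a = x"
proof (cases x rule: ennreal_cases)
  case (real y)
  then show ?thesis using assms by (simp add: epow_ennreal powr_powr)
qed (simp add: epow_def)

lemma Xp_integrable:
  assumes p: "1 < p" and f: "f \<in> Xp p"
  shows "f \<in> borel_measurable lebesgue" "set_integrable lebesgue {-pi..pi} f" "periodic_2pi f"
proof -
  show "periodic_2pi f" using f by (simp add: Xp_def)
  show m: "f \<in> borel_measurable lebesgue"
    using f by (auto simp: Xp_def borel_measurable_lebesgue_continuous split: if_splits)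
  show "set_integrable lebesgue {-pi..pi} f"
  proof (cases "p = \<infinity>")
    case True
    then have "continuous_on UNIV f" using f by (simp add: Xp_def)
    then show ?thesis by (intro absolutely_integrable_continuous_real) (rule continuous_on_subset, auto)
  next
    case False
    then obtain P where P: "p = ennreal P" "0 \<le> P" by (cases p rule: ennreal_cases) auto
    then have P1: "1 < P" using p by (simp add: ennreal_less_iff flip: ennreal_1)
    have i: "set_integrable lebesgue {-pi..pi} (\<lambda>t. \<bar>f t\<bar> powr P)" using f False P by (simp add: Xp_def)
    have c: "set_integrable lebesgue {-pi..pi} (\<lambda>t. 1 :: real)"
      by (intro absolutely_integrable_continuous_real continuous_intros)
    show ?thesis
    proof (rule set_integral_abs_bound(1)[OF _ m set_integral_add(1)[OF c i]])
      show "\<bar>f t\<bar> \<le> 1 + \<bar>f t\<bar> powr P" for t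
      proof (cases "\<bar>f t\<bar> \<le> 1")
        case False
        then have "\<bar>f t\<bar> powr 1 \<le> \<bar>f t\<bar> powr P" using P1 by (intro powr_mono) auto
        then show ?thesis using False by simp
      qed (simp add: add_increasing2)
    qed simp
  qed
qed

text \<open>\<open>E\<close> lies strictly above \<open>6 * \<omega> \<gamma>\<close>, hence is
  positive even when the modulus vanishes there, as both strong mean bounds demand. The factor
  \<open>9\<close> covers \<open>9 powr (1 / P)\<close> for finite \<open>p\<close> and
  \<open>2\<close> for \<open>p = \<infinity>\<close>.\<close>

lemma Xnorm_strong_mean_le:
  fixes p :: ennreal and f \<omega> :: "real \<Rightarrow> real" and k :: "nat \<Rightarrow> nat"
  assumes p: "1 < p" and q: "2 \<le> q" and sq: "1 / s + 1 / q = 1" and q': "0 < q'" "q' \<le> q"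
    and f: "f \<in> Xp_class p s \<omega>" and k: "strict_mono_on {0..r} k"
    and E: "6 * \<omega> (pi / (real (k 0) + 1)) < E" "0 \<le> \<omega> (pi / (real (k 0) + 1))"
  shows "Xnorm p (\<lambda>x. ennreal \<bar>strong_mean q' r k f x\<bar>)
    \<le> ennreal (9 * weight_total (if p = \<infinity> then 2 else enn2real p) q r k * E)"
proof -
  define \<gamma> where "\<gamma> = pi / (real (k 0) + 1)"
  have \<gamma>: "\<gamma> > 0" by (simp add: \<gamma>_def)
  have E0: "E > 0" using E by simp
  have fX: "f \<in> Xp p" and fG: "Xnorm p (\<lambda>x. Gcirc s f x \<gamma>) \<le> ennreal (\<omega> \<gamma>)"
    using f \<gamma> by (auto simp: Xp_class_def)
  note fi = Xp_integrable[OF p fX]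
  define h where "h = fejer_mean (k 0) f"
  have hr: "h \<in> reproduced i" if "k 0 \<le> i" for i
    unfolding h_def by (rule fejer_mean_reproduced[OF that])
  define g where "g = (\<lambda>x. f x - h x)"
  have gm: "g \<in> borel_measurable lebesgue" and gi: "set_integrable lebesgue {-pi..pi} g" and gp: "periodic_2pi g"
    using fi reproducedD[OF hr[OF order_refl]]
    by (auto simp: g_def periodic_2pi_def intro!: set_integral_diff)
  have sm: "strong_mean q' r k f x = strong_mean q' r k g x" for x
  proof -
    have "fourier_partial_sum (k \<nu>) g x - g x = fourier_partial_sum (k \<nu>) f x - f x" if "\<nu> \<in> {0..r}" for \<nu>
    proof -
      have "k 0 \<le> k \<nu>" using strict_mono_on_leD[OF k, of 0 \<nu>] that by auto
      from fourier_partial_sum_minus_reproduced[OF fi(1,2) hr[OF this], of x]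
      show ?thesis by (simp add: g_def)
    qed
    then show ?thesis unfolding strong_mean_def by simp
  qed
  have gG: "ennreal (\<bar>g x\<bar> / 6) \<le> Gcirc s f x \<gamma>" if "\<bar>x\<bar> \<le> pi" for x
    using fejer_mean_le_Gcirc[OF fi that q sq, of "k 0"] by (simp add: g_def h_def \<gamma>_def)
  have sm0: "\<bar>strong_mean q' r k g x\<bar> = strong_mean q' r k g x" for x by (simp add: strong_mean_def)
  show ?thesis
  proof (cases "p = \<infinity>")
    case True
    have gE: "\<bar>g x\<bar> \<le> E" if x: "\<bar>x\<bar> \<le> pi" for x
    proof -
      have "ennreal (\<bar>g x\<bar> / 6) \<le> (SUP x\<in>{-pi..pi}. Gcirc s f x \<gamma>)"
        using x by (intro order_trans[OF gG[OF x]] SUP_upper) auto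
      also have "\<dots> \<le> ennreal (\<omega> \<gamma>)" using fG True by (simp add: Xnorm_def)
      finally have "\<bar>g x\<bar> / 6 \<le> \<omega> \<gamma>" using E by (simp add: \<gamma>_def)
      then show ?thesis using E by (simp add: \<gamma>_def)
    qed
    have "continuous_on UNIV f" using fX True by (simp add: Xp_def)
    then have gc: "continuous_on UNIV g"
      unfolding g_def using reproducedD(1)[OF hr[OF order_refl]] by (intro continuous_intros)
    have "Xnorm p (\<lambda>x. ennreal \<bar>strong_mean q' r k f x\<bar>) = (SUP x\<in>{-pi..pi}. ennreal (strong_mean q' r k g x))"
      using True by (simp add: Xnorm_def sm sm0)
    also have "\<dots> \<le> ennreal (9 * weight_total 2 q r k * E)"
    proof (rule SUP_least)
      fix x assume "x \<in> {-pi..pi}"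
      then have "\<bar>x\<bar> \<le> pi" by auto
      from strong_mean_sup_bound[OF q q' k gc gp E0 gE this]
      have "strong_mean q' r k g x \<le> 2 * weight_total 2 q r k * E" .
      also have "\<dots> \<le> 9 * weight_total 2 q r k * E"
        using weight_total_ge_1[of 2 q r k] q E0 by (intro mult_right_mono) auto
      finally show "ennreal (strong_mean q' r k g x) \<le> ennreal (9 * weight_total 2 q r k * E)" by (rule ennreal_leI)
    qed
    finally show ?thesis using True by simp
  next
    case False
    then obtain P where P: "p = ennreal P" "0 \<le> P" by (cases p rule: ennreal_cases) auto
    then have P1: "1 < P" using p by (simp add: ennreal_less_iff flip: ennreal_1)
    have pP: "enn2real p = P" using P by simp
    define W where "W = weight_total P q r k"
    have W: "W \<ge> 1" unfolding W_def using P1 q by (intro weight_total_ge_1) auto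
    let ?N = "\<integral>\<^sup>+x\<in>{-pi..pi}. epow (Gcirc s f x \<gamma>) P \<partial>lebesgue"
    have "epow ?N (1 / P) \<le> ennreal (\<omega> \<gamma>)" using fG False by (simp add: Xnorm_def pP)
    \<comment> \<open>On \<open>[0, \<infinity>]\<close> the power \<open>P\<close> undoes the root,
      so \<open>?N\<close> is seen to be finite although \<open>Gcirc\<close> may be infinite at
      some points.\<close>
    then have "epow (epow ?N (1 / P)) P \<le> epow (ennreal (\<omega> \<gamma>)) P" using P1 by (intro epow_mono) auto
    then have N: "?N \<le> ennreal (\<omega> \<gamma> powr P)"
      using P1 E by (simp add: epow_epow_inverse epow_ennreal \<gamma>_def)
    have [measurable]: "(\<lambda>x. ennreal ((\<bar>g x\<bar> / 6) powr P)) \<in> borel_measurable lebesgue"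
      using gm by measurable
    have "(\<integral>\<^sup>+x\<in>{-pi..pi}. ennreal (\<bar>g x\<bar> powr P) \<partial>lebesgue)
        = (\<integral>\<^sup>+x. ennreal (6 powr P) * (ennreal ((\<bar>g x\<bar> / 6) powr P) * indicator {-pi..pi} x) \<partial>lebesgue)"
    proof (intro nn_integral_cong)
      fix x
      have "\<bar>g x\<bar> powr P = 6 powr P * (\<bar>g x\<bar> / 6) powr P" by (simp add: powr_divide)
      then show "ennreal (\<bar>g x\<bar> powr P) * indicator {-pi..pi} x
        = ennreal (6 powr P) * (ennreal ((\<bar>g x\<bar> / 6) powr P) * indicator {-pi..pi} x)"
        by (simp add: ennreal_mult mult.assoc)
    qed
    also have "\<dots> = ennreal (6 powr P) * (\<integral>\<^sup>+x\<in>{-pi..pi}. ennreal ((\<bar>g x\<bar> / 6) powr P) \<partial>lebesgue)"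
      by (intro nn_integral_cmult) measurable
    also have "\<dots> \<le> ennreal (6 powr P) * ?N"
    proof (intro mult_left_mono nn_integral_mono)
      fix x
      show "ennreal ((\<bar>g x\<bar> / 6) powr P) * indicator {-pi..pi} x \<le> epow (Gcirc s f x \<gamma>) P * indicator {-pi..pi} x"
      proof (cases "x \<in> {-pi..pi}")
        case True
        then have "\<bar>x\<bar> \<le> pi" by auto
        from epow_mono[OF gG[OF this], of P] P1 show ?thesis
          by (simp add: epow_ennreal mult_right_mono)
      qed simp
    qed simp
    also have "\<dots> \<le> ennreal (6 powr P) * ennreal (\<omega> \<gamma> powr P)" using N by (intro mult_left_mono) auto
    also have "\<dots> = ennreal ((6 * \<omega> \<gamma>) powr P)" using E by (simp add: ennreal_mult powr_mult \<gamma>_def)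
    also have "\<dots> \<le> ennreal (E powr P)" using E P1 by (intro ennreal_leI powr_mono2) (auto simp: \<gamma>_def)
    finally have gE: "(\<integral>\<^sup>+x\<in>{-pi..pi}. ennreal (\<bar>g x\<bar> powr P) \<partial>lebesgue) \<le> ennreal (E powr P)" .
    have "Xnorm p (\<lambda>x. ennreal \<bar>strong_mean q' r k f x\<bar>)
        = epow (\<integral>\<^sup>+x\<in>{-pi..pi}. ennreal (strong_mean q' r k g x powr P) \<partial>lebesgue) (1 / P)"
      using False by (simp add: Xnorm_def pP sm sm0 epow_ennreal strong_mean_def[of _ _ _ g])
    also have "\<dots> \<le> epow (ennreal (9 * (W * E) powr P)) (1 / P)"
      using P1 strong_mean_Lp_bound[OF P1 q q' k gm gi gp E0 gE] unfolding W_def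
      by (intro epow_mono) auto
    also have "\<dots> = ennreal (9 powr (1 / P) * (W * E))"
      using W E0 P1 by (simp add: epow_ennreal powr_mult powr_powr)
    also have "\<dots> \<le> ennreal (9 * W * E)"
    proof (rule ennreal_leI)
      have "(9::real) powr (1 / P) \<le> 9 powr 1" using P1 by (intro powr_mono) auto
      then have "9 powr (1 / P) * (W * E) \<le> 9 * (W * E)" using W E0 by (intro mult_right_mono) auto
      then show "9 powr (1 / P) * (W * E) \<le> 9 * W * E" by simp
    qed
    finally show ?thesis using False by (simp add: pP W_def)
  qed
qed

theorem theorem2:
  fixes p :: ennreal and q s q' :: real
  assumes "1 < p" and "2 \<le> q" and "1 / s + 1 / q = 1" and "0 < q'" and "q' \<le> q"
  shows "\<exists>K :: real \<Rightarrow> real. (\<forall>\<rho>>1. K \<rho> > 0) \<and> antimono_on {1<..} K \<and>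
    (\<forall>(\<omega> :: real \<Rightarrow> real) (f :: real \<Rightarrow> real) (r :: nat) (k :: nat \<Rightarrow> nat).
       modulus_of_continuity \<omega> \<longrightarrow> f \<in> Xp_class p s \<omega> \<longrightarrow> strict_mono_on {0..r} k \<longrightarrow>
       Xnorm p (\<lambda>x. ennreal \<bar>strong_mean q' r k f x\<bar>)
         \<le> ennreal (K (log_arg r k) * \<omega> (pi / (real (k 0) + 1)) * ln (log_arg r k)))"
proof -
  define P where "P = (if p = \<infinity> then 2 else enn2real p)"
  have P: "1 < P"
  proof (cases p rule: ennreal_cases)
    case (real a)
    then show ?thesis using assms(1) by (simp add: P_def ennreal_less_iff flip: ennreal_1)
  qed (simp add: P_def)
  \<comment> \<open>\<open>54 = 6 * 9\<close>, with \<open>6\<close> from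
    \<open>fejer_mean_le_Gcirc\<close> and \<open>9\<close> from
    \<open>Xnorm_strong_mean_le\<close>; the other factor is that of
    \<open>weight_total_le\<close>.\<close>
  define C where "C = 54 * (9 + 4 / (1 - decay_ratio P q))"
  have C: "C > 0" using decay_ratio_bounds[of P q] P assms(2) by (simp add: C_def add_pos_pos)
  \<comment> \<open>chosen so that \<open>K \<rho> * ln \<rho> = C * (1 + ln \<rho>)\<close>\<close>
  define K where "K = (\<lambda>\<rho>. C * (1 + 1 / ln \<rho>))"
  show ?thesis
  proof (intro exI[of _ K] conjI allI impI)
    show "K \<rho> > 0" if "\<rho> > 1" for \<rho>
      using that C by (simp add: K_def add_pos_pos)
    show "antimono_on {1<..} K"
      using C by (auto simp: monotone_on_def K_def intro!: mult_left_mono divide_left_mono)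
    fix \<omega> f :: "real \<Rightarrow> real" and r :: nat and k :: "nat \<Rightarrow> nat"
    assume \<omega>: "modulus_of_continuity \<omega>" and f: "f \<in> Xp_class p s \<omega>" and k: "strict_mono_on {0..r} k"
    define \<gamma> where "\<gamma> = pi / (real (k 0) + 1)"
    have "\<omega> 0 \<le> \<omega> \<gamma>"
      using \<omega> by (intro mono_onD[of "{0..}" \<omega>]) (auto simp: modulus_of_continuity_def \<gamma>_def)
    then have \<omega>0: "0 \<le> \<omega> \<gamma>" using \<omega> by (simp add: modulus_of_continuity_def)
    define L where "L = 1 + ln (log_arg r k)"
    have L: "L > 1" using log_arg_bounds(1)[OF k] by (simp add: L_def)
    define D where "D = 9 * (9 + 4 / (1 - decay_ratio P q)) * L"
    have D: "D > 0" using L C by (auto simp: D_def C_def)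
    have *: "Xnorm p (\<lambda>x. ennreal \<bar>strong_mean q' r k f x\<bar>) \<le> ennreal (D * E)" if "6 * \<omega> \<gamma> < E" for E
    proof -
      have "Xnorm p (\<lambda>x. ennreal \<bar>strong_mean q' r k f x\<bar>) \<le> ennreal (9 * weight_total P q r k * E)"
        unfolding P_def by (rule Xnorm_strong_mean_le[OF assms f k]) (use that \<omega>0 in \<open>simp_all add: \<gamma>_def\<close>)
      also have "\<dots> \<le> ennreal (D * E)"
      proof (intro ennreal_leI mult_right_mono)
        have "weight_total P q r k \<le> (9 + 4 / (1 - decay_ratio P q)) * L"
          unfolding L_def using assms(2) by (intro weight_total_le k P) simp
        then show "9 * weight_total P q r k \<le> D" unfolding D_def mult.assoc by (intro mult_left_mono) auto
      qed (use that \<omega>0 in simp)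
      finally show ?thesis .
    qed
    \<comment> \<open>The fact \<open>*\<close> requires a strict inequality, so it is applied to
      \<open>E = 6 * \<omega> \<gamma> + e / D\<close>, which exceeds the desired bound by exactly
      \<open>e\<close>; then \<open>e\<close> tends to \<open>0\<close>.\<close>
    have "Xnorm p (\<lambda>x. ennreal \<bar>strong_mean q' r k f x\<bar>) \<le> ennreal (D * (6 * \<omega> \<gamma>))"
    proof (rule ennreal_le_epsilon)
      fix e :: real assume e: "e > 0"
      have "Xnorm p (\<lambda>x. ennreal \<bar>strong_mean q' r k f x\<bar>) \<le> ennreal (D * (6 * \<omega> \<gamma> + e / D))"
        using e D by (intro *) simp
      also have "\<dots> = ennreal (D * (6 * \<omega> \<gamma>)) + ennreal e"
        using e D \<omega>0 by (simp add: distrib_left ennreal_plus[symmetric] del: ennreal_plus)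
      finally show "Xnorm p (\<lambda>x. ennreal \<bar>strong_mean q' r k f x\<bar>) \<le> ennreal (D * (6 * \<omega> \<gamma>)) + ennreal e" .
    qed
    also have "D * (6 * \<omega> \<gamma>) = K (log_arg r k) * \<omega> \<gamma> * ln (log_arg r k)"
    proof -
      have "9 * c * (1 + l) * (6 * y) = 54 * c * (1 + 1 / l) * y * l" if "l > 0" for c l y :: real
        using that by (simp add: field_simps)
      from this[OF ln_gt_zero[OF log_arg_bounds(1)[OF k]]] show ?thesis
        unfolding D_def K_def C_def L_def .
    qed
    finally show "Xnorm p (\<lambda>x. ennreal \<bar>strong_mean q' r k f x\<bar>)
         \<le> ennreal (K (log_arg r k) * \<omega> (pi / (real (k 0) + 1)) * ln (log_arg r k))"
      by (simp add: \<gamma>_def)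
  qed
qed

end
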